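(* Let $H$ be a separable real Hilbert space, $A$ a self-adjoint, positive coercive operator on $H$, $\lambda_1=\lambda_1(A)$ the smallest spectral value of $A$, and $V=D(A^{1/2})$. Let $c\in\mathbb{R}$ with $c\neq0$ and $|c|<\lambda_1$. Then there exists a constant $C>0$ such that for every weak solution $(u,v)$ of $$u''+u'+Au+cv=0,\qquad v''+Av+cu=0, \qquad (S)$$ one has $$\forall t>0,\quad |u(t)|^2+|v(t)|^2+\|u'(t)\|_*^2+\|v'(t)\|_*^2\le C\,\frac{E_0}{t},$$ where $$E_0=\|u(0)\|^2+\|v(0)\|^2+|u'(0)|^2+|v'(0)|^2 .$$
   Context: $|\cdot|$ is the norm of $H$. $V=D(A^{1/2})$ has norm $\|u\|=|A^{1/2}u|$; $H$ is identified with its dual so that $V\subset H\subset V'$, and $A$ is extended to an operator in $L(V,V')$. $\lambda_1$ is the largest constant with $\|u\|^2\ge\lambda_1|u|^2$ for all $u\in V$. $\|\cdot\|_*$ is the norm of $V'$ dual to that of $V$: $\|f\|_*^2=\langle f,A^{-1}f\rangle$, so $\|f\|_*=|A^{-1/2}f|$ for $f\in H$. A weak solution of $(S)$ is a pair $(u,v)$ with $(u,v,u',v')\in C(\mathbb{R}^+,V\times V\times H\times H)\cap C^1(\mathbb{R}^+,H\times H\times V'\times V')$ satisfying $(S)$ in $V'$. *)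

theory Defs
  imports "HOL-Analysis.Analysis"
begin

text \<open>
  A real Hilbert space \<open>H\<close> is a type of class \<open>{real_inner, complete_space}\<close>. An unbounded
  operator on \<open>H\<close> is represented by its graph, a linear subspace of \<open>H \<times> H\<close>; its domain is then
  \<open>Domain G\<close>, and composition of operators (with the maximal domain) is relation composition.
\<close>

type_synonym 'h operator = "('h \<times> 'h) set"

definition linear_operator :: "'h::real_inner operator \<Rightarrow> bool" where
  "linear_operator G \<longleftrightarrow> subspace G \<and> single_valued G"

definition op_app :: "'h operator \<Rightarrow> 'h \<Rightarrow> 'h" where
  "op_app G x = (THE y. (x, y) \<in> G)"

definition op_adjoint :: "'h::real_inner operator \<Rightarrow> 'h operator" where
  "op_adjoint G = {(y, z). \<forall>(x, w) \<in> G. w \<bullet> y = x \<bullet> z}"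

definition self_adjoint :: "'h::real_inner operator \<Rightarrow> bool" where
  "self_adjoint G \<longleftrightarrow> linear_operator G \<and> closure (Domain G) = UNIV \<and> op_adjoint G = G"

definition nonneg_operator :: "'h::real_inner operator \<Rightarrow> bool" where
  "nonneg_operator G \<longleftrightarrow> (\<forall>(x, y) \<in> G. 0 \<le> y \<bullet> x)"

definition coercive :: "'h::real_inner operator \<Rightarrow> bool" where
  "coercive G \<longleftrightarrow> (\<exists>\<alpha>>0. \<forall>(x, y) \<in> G. \<alpha> * (norm x)\<^sup>2 \<le> y \<bullet> x)"

text \<open>
  \<open>\<mu>\<close> is in the resolvent set iff \<open>G - \<mu> I\<close> is a bijection from \<open>Domain G\<close> onto \<open>H\<close> with bounded
  inverse \<open>R\<close>. Only real \<open>\<mu>\<close> are considered: the spectrum (of the complexification) of a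
  self-adjoint operator is real, and for real \<open>\<mu>\<close> invertibility of \<open>G - \<mu> I\<close> over the reals and
  over the complex numbers agree.
\<close>

definition resolvent_set :: "'h::real_inner operator \<Rightarrow> real set" where
  "resolvent_set G =
    {\<mu>. \<exists>R. bounded_linear R \<and> {(x, y - \<mu> *\<^sub>R x) | x y. (x, y) \<in> G} = {(R z, z) | z. True}}"

definition spectrum :: "'h::real_inner operator \<Rightarrow> real set" where
  "spectrum G = - resolvent_set G"

text \<open>On the trivial space \<open>H = {0}\<close> the spectrum is empty and this value is unspecified.\<close>

definition lambda1 :: "'h::real_inner operator \<Rightarrow> real" where
  "lambda1 G = (LEAST \<mu>. \<mu> \<in> spectrum G)"

definition sqrt_op :: "'h::real_inner operator \<Rightarrow> 'h operator" where
  "sqrt_op G = (THE S. self_adjoint S \<and> nonneg_operator S \<and> S O S = G)"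

definition V_space :: "'h::real_inner operator \<Rightarrow> 'h set" where
  "V_space A = Domain (sqrt_op A)"

definition V_norm :: "'h::real_inner operator \<Rightarrow> 'h \<Rightarrow> real" where
  "V_norm A x = norm (op_app (sqrt_op A) x)"

text \<open>
  \<open>V'\<close> consists of the bounded linear functionals on \<open>V\<close>. Such a functional is represented by a
  function on the whole of \<open>H\<close> that vanishes outside \<open>V\<close>, so that equality in \<open>V'\<close> is equality of
  functions and the vector space operations of \<open>V'\<close> are pointwise.
\<close>

definition V_dual :: "'h::real_inner operator \<Rightarrow> ('h \<Rightarrow> real) set" where
  "V_dual A = {f. (\<forall>x \<in> V_space A. \<forall>y \<in> V_space A. f (x + y) = f x + f y) \<and>
                  (\<forall>r. \<forall>x \<in> V_space A. f (r *\<^sub>R x) = r * f x) \<and>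
                  (\<exists>K. \<forall>x \<in> V_space A. \<bar>f x\<bar> \<le> K * V_norm A x) \<and>
                  (\<forall>x. x \<notin> V_space A \<longrightarrow> f x = 0)}"

definition dual_norm :: "'h::real_inner operator \<Rightarrow> ('h \<Rightarrow> real) \<Rightarrow> real" where
  "dual_norm A f = (SUP w \<in> {w \<in> V_space A. V_norm A w \<le> 1}. \<bar>f w\<bar>)"

text \<open>The inclusion of \<open>H\<close> into \<open>V'\<close>, given by the identification of \<open>H\<close> with its dual.\<close>

definition H_to_dual :: "'h::real_inner operator \<Rightarrow> 'h \<Rightarrow> ('h \<Rightarrow> real)" where
  "H_to_dual A h = (\<lambda>w. if w \<in> V_space A then h \<bullet> w else 0)"

text \<open>
  The extension of \<open>A\<close> to a bounded operator from \<open>V\<close> to \<open>V'\<close>. For \<open>x\<close> in the domain of \<open>A\<close> and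
  \<open>w\<close> in \<open>V\<close> one has \<open>\<langle>A x, w\<rangle> = \<langle>A\<^sup>1\<^sup>/\<^sup>2 x, A\<^sup>1\<^sup>/\<^sup>2 w\<rangle>\<close>, and the right-hand side makes sense on \<open>V\<close>.
\<close>

definition A_ext :: "'h::real_inner operator \<Rightarrow> 'h \<Rightarrow> ('h \<Rightarrow> real)" where
  "A_ext A x =
    (\<lambda>w. if w \<in> V_space A then op_app (sqrt_op A) x \<bullet> op_app (sqrt_op A) w else 0)"

text \<open>
  Regularity of functions on \<open>[0, \<infinity>)\<close>, with one-sided limits at \<open>0\<close>; values at negative
  times play no role.
\<close>

definition continuous_into_V :: "'h::real_inner operator \<Rightarrow> (real \<Rightarrow> 'h) \<Rightarrow> bool" where
  "continuous_into_V A u \<longleftrightarrow>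
    (\<forall>t\<ge>0. u t \<in> V_space A \<and> ((\<lambda>s. V_norm A (u s - u t)) \<longlongrightarrow> 0) (at t within {0..}))"

definition continuous_into_dual ::
    "'h::real_inner operator \<Rightarrow> (real \<Rightarrow> 'h \<Rightarrow> real) \<Rightarrow> bool" where
  "continuous_into_dual A f \<longleftrightarrow>
    (\<forall>t\<ge>0. f t \<in> V_dual A \<and>
           ((\<lambda>s. dual_norm A (\<lambda>w. f s w - f t w)) \<longlongrightarrow> 0) (at t within {0..}))"

definition has_derivative_in_dual ::
    "'h::real_inner operator \<Rightarrow> (real \<Rightarrow> 'h \<Rightarrow> real) \<Rightarrow> (real \<Rightarrow> 'h \<Rightarrow> real) \<Rightarrow> bool" where
  "has_derivative_in_dual A f f' \<longleftrightarrow>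
    (\<forall>t\<ge>0. ((\<lambda>s. dual_norm A (\<lambda>w. (f s w - f t w) / (s - t) - f' t w)) \<longlongrightarrow> 0)
             (at t within {0..}))"

text \<open>
  \<open>u\<close> is of class \<open>C([0,\<infinity>), V) \<inter> C\<^sup>1([0,\<infinity>), H)\<close> with derivative \<open>u1\<close>, which is of class
  \<open>C([0,\<infinity>), H) \<inter> C\<^sup>1([0,\<infinity>), V')\<close> with derivative \<open>u2\<close> in \<open>V'\<close>.
\<close>

definition weak_regularity ::
    "'h::real_inner operator \<Rightarrow> (real \<Rightarrow> 'h) \<Rightarrow> (real \<Rightarrow> 'h) \<Rightarrow> (real \<Rightarrow> 'h \<Rightarrow> real) \<Rightarrow> bool" where
  "weak_regularity A u u1 u2 \<longleftrightarrow>
    continuous_into_V A u \<and>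
    (\<forall>t\<ge>0. (u has_vector_derivative u1 t) (at t within {0..})) \<and>
    continuous_on {0..} u1 \<and>
    has_derivative_in_dual A (\<lambda>t. H_to_dual A (u1 t)) u2 \<and>
    continuous_into_dual A u2"

text \<open>
  \<open>(u, v)\<close> is a weak solution of \<open>u'' + u' + A u + c v = 0\<close>, \<open>v'' + A v + c u = 0\<close>, and
  \<open>u1 = u'\<close>, \<open>v1 = v'\<close> on \<open>[0, \<infinity>)\<close>.
\<close>

definition weak_solution ::
    "'h::real_inner operator \<Rightarrow> real \<Rightarrow> (real \<Rightarrow> 'h) \<Rightarrow> (real \<Rightarrow> 'h) \<Rightarrow>
     (real \<Rightarrow> 'h) \<Rightarrow> (real \<Rightarrow> 'h) \<Rightarrow> bool" where
  "weak_solution A c u v u1 v1 \<longleftrightarrow>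
    (\<exists>u2 v2.
      weak_regularity A u u1 u2 \<and> weak_regularity A v v1 v2 \<and>
      (\<forall>t\<ge>0.
        (\<lambda>w. u2 t w + H_to_dual A (u1 t) w + A_ext A (u t) w + c * H_to_dual A (v t) w) = (\<lambda>w. 0) \<and>
        (\<lambda>w. v2 t w + A_ext A (v t) w + c * H_to_dual A (u t) w) = (\<lambda>w. 0)))"

end

theory Submission
  imports Defs
begin

text \<open>
  Write \<open>B = A\<^sup>-\<^sup>1\<close> and \<open>T = B\<^sup>1\<^sup>/\<^sup>2\<close>. The operator \<open>A\<close> is bounded below by \<open>\<lambda>\<^sub>1\<close>, and \<open>k = |c|/\<lambda>\<^sub>1 < 1\<close> makes
  both the energy \<open>E\<close> and its weak analogue \<open>F\<close>, obtained by applying \<open>T\<close> to all components, equivalent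
  to the squared norms; \<open>E' = -|u'|\<^sup>2\<close> and \<open>F' \<le> 0\<close>. The undamped component is controlled by the multipliers
  \<open>\<langle>u', v\<rangle> - \<langle>u, v'\<rangle>\<close>, with derivative \<open>c|u|\<^sup>2 - c|v|\<^sup>2 - \<langle>u', v\<rangle>\<close>, and \<open>\<langle>u', Bu\<rangle>\<close>,
  whose derivative contains \<open>-|u|\<^sup>2 - c\<langle>v, Bu\<rangle>\<close>; twice the second added to \<open>1/c\<close> times the first gives
  \<open>-|u|\<^sup>2 - |v|\<^sup>2 - 2c\<langle>v, Bu\<rangle>\<close>, which is negative definite because \<open>k < 1\<close>. A small multiple of
  \<open>\<langle>v', Bv\<rangle>\<close> then controls \<open>v'\<close> in \<open>V'\<close>. So \<open>M E\<close> plus these corrections is a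
  nonnegative functional \<open>L\<close> with \<open>L' \<le> -\<eta> F\<close>, hence \<open>L + \<eta> t F\<close> is nonincreasing and \<open>t F(t)\<close> is bounded by
  the initial energy. Weak solutions are too irregular for this computation. It is carried out for their images
  under \<open>T (T + \<epsilon>)\<^sup>-\<^sup>1\<close>, which commutes with the equation and tends strongly to the identity.
\<close>

subsection \<open>Self-adjoint operators bounded below\<close>

text \<open>The distance from \<open>f\<close> to \<open>M\<close> is attained: a minimizing
  sequence is Cauchy by the parallelogram law. At the minimizer \<open>g\<close> the first variation
  vanishes, so \<open>f - g\<close> is orthogonal to \<open>M\<close>.\<close>

lemma closed_subspace_orthogonal:
  fixes M :: "'h::{real_inner, complete_space} set"
  assumes M: "subspace M" "closed M" and f: "f \<notin> M"
  obtains z where "z \<noteq> 0" "\<And>x. x \<in> M \<Longrightarrow> x \<bullet> z = 0"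
proof -
  define d where "d = infdist f M"
  have ne: "M \<noteq> {}" using subspace_0[OF M(1)] by auto
  have le: "d \<le> norm (f - x)" if "x \<in> M" for x
    using infdist_le[OF that, of f] by (simp add: d_def dist_norm)
  have d0: "d \<ge> 0" by (simp add: d_def infdist_nonneg)
  have "\<exists>x\<in>M. norm (f - x) < d + 1 / Suc n" for n
  proof (rule ccontr)
    assume "\<not> ?thesis"
    then have "d + 1 / Suc n \<le> infdist f M"
      unfolding infdist_notempty[OF ne] by (intro cINF_greatest[OF ne]) (auto simp: dist_norm not_less)
    then show False by (simp add: d_def)
  qed
  then obtain X where X: "\<And>n. X n \<in> M" "\<And>n. norm (f - X n) < d + 1 / Suc n" by metis
  \<comment> \<open>Parallelogram law for \<open>f - X m\<close> and \<open>f - X n\<close>: the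
    midpoint of \<open>X m\<close> and \<open>X n\<close> stays in \<open>M\<close>, hence at
    distance at least \<open>d\<close> from \<open>f\<close>.\<close>
  have par: "(norm (X m - X n))\<^sup>2 \<le> 2 * (norm (f - X m))\<^sup>2 + 2 * (norm (f - X n))\<^sup>2 - 4 * d\<^sup>2" for m n
  proof -
    have "(1/2) *\<^sub>R (X m + X n) \<in> M" using X(1) M(1) by (simp add: subspace_add subspace_scale)
    then have "d\<^sup>2 \<le> (norm (f - (1/2) *\<^sub>R (X m + X n)))\<^sup>2" using le d0 by (simp add: power_mono)
    then show ?thesis
      by (simp add: power2_norm_eq_inner inner_diff inner_add inner_commute algebra_simps)
  qed
  have lim: "(\<lambda>n. norm (f - X n)) \<longlonglongrightarrow> d"
  proof (rule tendsto_sandwich[of "\<lambda>_. d"])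
    have "(\<lambda>n. d + 1 / Suc n) \<longlonglongrightarrow> d + 0"
      by (intro tendsto_intros LIMSEQ_Suc[OF lim_1_over_n])
    then show "(\<lambda>n. d + 1 / Suc n) \<longlonglongrightarrow> d" by simp
  qed (use le X in \<open>auto intro!: always_eventually less_imp_le\<close>)
  have "Cauchy X"
  proof (rule CauchyI)
    fix e :: real assume e: "e > 0"
    have "(\<lambda>n. (norm (f - X n))\<^sup>2) \<longlonglongrightarrow> d\<^sup>2" by (intro tendsto_intros lim)
    then have "\<forall>\<^sub>F n in sequentially. (norm (f - X n))\<^sup>2 < d\<^sup>2 + e\<^sup>2 / 4"
      by (rule order_tendstoD) (use e in simp)
    then obtain N where N: "\<And>n. n \<ge> N \<Longrightarrow> (norm (f - X n))\<^sup>2 < d\<^sup>2 + e\<^sup>2 / 4"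
      by (auto simp: eventually_sequentially)
    have "norm (X m - X n) < e" if "m \<ge> N" "n \<ge> N" for m n
    proof (rule power2_less_imp_less)
      show "(norm (X m - X n))\<^sup>2 < e\<^sup>2" using par[of m n] N[OF that(1)] N[OF that(2)] by linarith
    qed (use e in simp)
    then show "\<exists>M. \<forall>m\<ge>M. \<forall>n\<ge>M. norm (X m - X n) < e" by blast
  qed
  then obtain g where g: "X \<longlonglongrightarrow> g" using Cauchy_convergent convergent_def by blast
  have gM: "g \<in> M" using closed_sequentially[OF M(2)] X(1) g by blast
  have "(\<lambda>n. norm (f - X n)) \<longlonglongrightarrow> norm (f - g)" by (intro tendsto_intros g)
  then have gd: "norm (f - g) = d" using lim LIMSEQ_unique by blast
  show thesis
  proof
    show "f - g \<noteq> 0" using gM f by auto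
    fix x assume x: "x \<in> M"
    show "x \<bullet> (f - g) = 0"
    proof (cases "x = 0")
      case False
      \<comment> \<open>This \<open>s\<close> minimizes the norm of
        \<open>f - g - s *\<^sub>R x\<close>; minimality of \<open>g\<close> leaves no gain, which
        forces the inner product to vanish.\<close>
      define s where "s = (x \<bullet> (f - g)) / (x \<bullet> x)"
      have "g + s *\<^sub>R x \<in> M" using gM x M(1) by (simp add: subspace_add subspace_scale)
      then have "(norm (f - g))\<^sup>2 \<le> (norm (f - (g + s *\<^sub>R x)))\<^sup>2"
        using le gd by (intro power_mono) auto
      also have "f - (g + s *\<^sub>R x) = (f - g) - s *\<^sub>R x" by simp
      also have "(norm ((f - g) - s *\<^sub>R x))\<^sup>2 = (norm (f - g))\<^sup>2 - 2 * s * (x \<bullet> (f - g)) + s\<^sup>2 * (x \<bullet> x)"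
        unfolding power2_norm_eq_inner inner_diff_left inner_diff_right
        by (simp add: inner_commute power2_eq_square algebra_simps)
      also have "\<dots> = (norm (f - g))\<^sup>2 - (x \<bullet> (f - g))\<^sup>2 / (x \<bullet> x)"
        using False by (simp add: s_def power2_eq_square)
      finally have "(x \<bullet> (f - g))\<^sup>2 / (x \<bullet> x) \<le> 0" by simp
      moreover have "x \<bullet> x > 0" using False by simp
      ultimately show ?thesis by (simp add: divide_le_0_iff)
    qed simp
  qed
qed

lemma self_adjointD:
  assumes "self_adjoint G"
  shows "subspace G" "closure (Domain G) = UNIV"
    "\<And>x y z. (x, y) \<in> G \<Longrightarrow> (x, z) \<in> G \<Longrightarrow> y = z"
    "\<And>y z. (y, z) \<in> G \<longleftrightarrow> (\<forall>(x, w) \<in> G. w \<bullet> y = x \<bullet> z)"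
proof -
  show "subspace G" "closure (Domain G) = UNIV"
    "\<And>x y z. (x, y) \<in> G \<Longrightarrow> (x, z) \<in> G \<Longrightarrow> y = z"
    using assms unfolding self_adjoint_def linear_operator_def single_valued_def by blast+
  have "op_adjoint G = G" using assms unfolding self_adjoint_def by blast
  then show "\<And>y z. (y, z) \<in> G \<longleftrightarrow> (\<forall>(x, w) \<in> G. w \<bullet> y = x \<bullet> z)"
    unfolding op_adjoint_def by blast
qed

lemma self_adjoint_symmetric:
  "self_adjoint G \<Longrightarrow> (x, w) \<in> G \<Longrightarrow> (y, z) \<in> G \<Longrightarrow> w \<bullet> y = x \<bullet> z"
  using self_adjointD(4) by fastforce

text \<open>The range is closed by coercivity, and an element orthogonal to it lies in the kernel of the
  adjoint.\<close>

lemma self_adjoint_bounded_below_inverse: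
  fixes G :: "'h::{real_inner, complete_space} operator"
  assumes G: "self_adjoint G" and \<alpha>: "\<alpha> > 0"
    and lower: "\<And>x y. (x, y) \<in> G \<Longrightarrow> \<alpha> * (norm x)\<^sup>2 \<le> y \<bullet> x"
  obtains R where "bounded_linear R" "G = {(R z, z) | z. True}"
proof -
  note G' = self_adjointD[OF G]
  have norm_le: "norm x \<le> norm y / \<alpha>" if "(x, y) \<in> G" for x y
  proof (cases "x = 0")
    case False
    have "\<alpha> * norm x * norm x \<le> norm y * norm x"
      using lower[OF that] norm_cauchy_schwarz[of y x] by (simp add: power2_eq_square)
    then show ?thesis using False \<alpha> by (simp add: field_simps)
  qed (use \<alpha> in simp)
  have sub: "subspace (Range G)"
    using linear_subspace_image[OF linear_snd G'(1)] by (simp add: Range_snd)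
  have clos: "closed (Range G)"
    unfolding closed_sequential_limits
  proof (intro allI impI, elim conjE)
    fix y l assume y: "\<forall>n. y n \<in> Range G" and l: "y \<longlonglongrightarrow> l"
    from y have "\<forall>n. \<exists>a. (a, y n) \<in> G" by blast
    then obtain x where x: "\<And>n. (x n, y n) \<in> G" by metis
    have "norm (x m - x n) \<le> norm (y m - y n) / \<alpha>" for m n
      using norm_le subspace_diff[OF G'(1) x x, of m n] by simp
    then have le: "norm (x m - x n) * \<alpha> \<le> norm (y m - y n)" for m n using \<alpha> by (simp add: field_simps)
    have "Cauchy x"
    proof (rule CauchyI)
      fix e :: real assume "e > 0"
      then have "e * \<alpha> > 0" using \<alpha> by simp
      then obtain N where "\<And>m n. m \<ge> N \<Longrightarrow> n \<ge> N \<Longrightarrow> norm (y m - y n) < e * \<alpha>"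
        using CauchyD[OF LIMSEQ_imp_Cauchy[OF l]] by metis
      then have "\<forall>m\<ge>N. \<forall>n\<ge>N. norm (x m - x n) < e"
        using le \<alpha> by (meson le_less_trans mult_less_cancel_right_pos)
      then show "\<exists>M. \<forall>m\<ge>M. \<forall>n\<ge>M. norm (x m - x n) < e" by blast
    qed
    then obtain g where g: "x \<longlonglongrightarrow> g" using Cauchy_convergent convergent_def by blast
    \<comment> \<open>The adjoint relation passes to limits, so self-adjointness puts the limit pair
      back into the graph.\<close>
    have "b \<bullet> g = a \<bullet> l" if "(a, b) \<in> G" for a b
    proof (rule LIMSEQ_unique)
      show "(\<lambda>n. b \<bullet> x n) \<longlonglongrightarrow> b \<bullet> g" by (intro tendsto_intros g)
      have "b \<bullet> x n = a \<bullet> y n" for n using self_adjoint_symmetric[OF G that x] .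
      then show "(\<lambda>n. b \<bullet> x n) \<longlonglongrightarrow> a \<bullet> l" by (auto intro!: tendsto_intros l)
    qed
    then have "(g, l) \<in> G" using G'(4) by blast
    then show "l \<in> Range G" by blast
  qed
  have "Range G = UNIV"
  proof (rule ccontr)
    assume "Range G \<noteq> UNIV"
    then obtain z where z: "z \<noteq> 0" "\<And>y. y \<in> Range G \<Longrightarrow> y \<bullet> z = 0"
      using closed_subspace_orthogonal[OF sub clos] by blast
    then have "(z, 0) \<in> G" using G'(4) by fastforce
    then show False using norm_le z(1) by fastforce
  qed
  then have "\<forall>z. \<exists>x. (x, z) \<in> G" by blast
  then obtain R where R: "\<And>z. (R z, z) \<in> G" by metis
  have uniq: "x = R z" if "(x, z) \<in> G" for x z
    using norm_le subspace_diff[OF G'(1) that R[of z]] by fastforce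
  have "bounded_linear R"
  proof (rule bounded_linear_intro[where K = "1 / \<alpha>"])
    show "R (x + y) = R x + R y" for x y using uniq subspace_add[OF G'(1) R R, of x y] by simp
    show "R (r *\<^sub>R x) = r *\<^sub>R R x" for r x using uniq subspace_scale[OF G'(1) R, of r x] by simp
    show "norm (R x) \<le> norm x * (1 / \<alpha>)" for x using norm_le[OF R] by simp
  qed
  moreover have "G = {(R z, z) | z. True}" using R uniq by auto
  ultimately show thesis by (rule that)
qed

lemma self_adjoint_shift:
  fixes G :: "'h::real_inner operator"
  assumes G: "self_adjoint G"
  shows "self_adjoint {(x, y - \<mu> *\<^sub>R x) | x y. (x, y) \<in> G}" (is "self_adjoint ?S")
proof -
  note G' = self_adjointD[OF G]
  have mem: "(x, y) \<in> ?S \<longleftrightarrow> (x, y + \<mu> *\<^sub>R x) \<in> G" for x y by force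
  have "subspace ?S"
    unfolding subspace_def
  proof (intro conjI ballI allI)
    show "0 \<in> ?S" using subspace_0[OF G'(1)] by (auto simp: zero_prod_def mem)
    show "a + b \<in> ?S" if "a \<in> ?S" "b \<in> ?S" for a b
      using that subspace_add[OF G'(1)] by (cases a, cases b) (fastforce simp: mem algebra_simps)
    show "r *\<^sub>R a \<in> ?S" if "a \<in> ?S" for r a
      using that subspace_scale[OF G'(1), of _ r] by (cases a) (fastforce simp: mem algebra_simps)
  qed
  moreover have "single_valued ?S" using G'(3) unfolding single_valued_def by blast
  moreover have "Domain ?S = Domain G" by blast
  moreover have "op_adjoint ?S = ?S"
  proof -
    have "(\<forall>(x, w)\<in>?S. w \<bullet> y = x \<bullet> z) \<longleftrightarrow> (\<forall>(x, w)\<in>G. w \<bullet> y = x \<bullet> (z + \<mu> *\<^sub>R y))" for y z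
    proof -
      have "(\<forall>(x, w)\<in>?S. w \<bullet> y = x \<bullet> z) \<longleftrightarrow> (\<forall>(x, w)\<in>G. (w - \<mu> *\<^sub>R x) \<bullet> y = x \<bullet> z)" by blast
      then show ?thesis by (simp add: inner_diff_left inner_add_right algebra_simps)
    qed
    then show ?thesis unfolding op_adjoint_def using G'(4) mem by auto
  qed
  ultimately show ?thesis using G unfolding self_adjoint_def linear_operator_def by simp
qed

section \<open>Bounded positive operators and the bottom of the spectrum\<close>

locale positive_operator = bounded_linear T
  for T :: "'h::real_inner \<Rightarrow> 'h" +
  assumes sym: "T x \<bullet> y = x \<bullet> T y" and pos: "0 \<le> T x \<bullet> x"
begin

text \<open>Evaluate the nonnegative quadratic form of \<open>T\<close> at
  \<open>x - (1 / K) *\<^sub>R T x\<close> and bound the term that is quadratic in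
  \<open>1 / K\<close> by the operator bound.\<close>

lemma norm_power2_le:
  assumes K: "K > 0" "\<And>x. norm (T x) \<le> K * norm x"
  shows "(norm (T x))\<^sup>2 \<le> K * (T x \<bullet> x)"
proof -
  have "0 \<le> T (x - (1 / K) *\<^sub>R T x) \<bullet> (x - (1 / K) *\<^sub>R T x)" by (rule pos)
  also have "\<dots> = T x \<bullet> x - 2 * (T x \<bullet> T x) / K + (T (T x) \<bullet> T x) / K\<^sup>2"
    using K(1) by (simp add: diff scaleR inner_diff_left inner_diff_right sym[of "T x" x] power2_eq_square field_simps)
  also have "\<dots> \<le> T x \<bullet> x - 2 * (T x \<bullet> T x) / K + K * (T x \<bullet> T x) / K\<^sup>2"
  proof -
    have "T (T x) \<bullet> T x \<le> norm (T (T x)) * norm (T x)" by (rule norm_cauchy_schwarz)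
    also have "\<dots> \<le> (K * norm (T x)) * norm (T x)" by (intro mult_right_mono K) simp
    finally have "T (T x) \<bullet> T x \<le> K * (T x \<bullet> T x)" by (simp add: dot_square_norm power2_eq_square mult.assoc)
    then show ?thesis by (simp add: divide_right_mono)
  qed
  also have "\<dots> = T x \<bullet> x - (norm (T x))\<^sup>2 / K" using K(1) by (simp add: dot_square_norm field_simps power2_eq_square)
  finally show ?thesis using K(1) by (simp add: field_simps)
qed

lemma eq_0: "T x \<bullet> x = 0 \<Longrightarrow> T x = 0"
proof -
  assume *: "T x \<bullet> x = 0"
  obtain K where "K > 0" "\<And>x. norm (T x) \<le> norm x * K" using pos_bounded by blast
  then show "T x = 0" using norm_power2_le[of K x] * by (simp add: mult.commute)
qed

end

text \<open>The infimum \<open>m\<close> of the Rayleigh quotients is the least spectral value. For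
  \<mu> below \<open>m\<close> the shifted operator is coercive, hence boundedly invertible. A
  bounded inverse \<open>R\<close> of \<open>A - m\<close> would be positive, and
  \<open>norm_power2_le\<close> for \<open>R\<close> would raise every quotient to at least
  \<open>m + 1 / K\<close>.\<close>

lemma lambda1_lower_bound:
  fixes A :: "'h::{real_inner, complete_space} operator"
  assumes A: "self_adjoint A" "nonneg_operator A" and xy: "(x, y) \<in> A"
  shows "lambda1 A * (norm x)\<^sup>2 \<le> y \<bullet> x"
proof (cases "x = 0")
  case x: False
  note A' = self_adjointD[OF A(1)]
  define W where "W = {y \<bullet> x / (norm x)\<^sup>2 | x y. (x, y) \<in> A \<and> x \<noteq> 0}"
  define m where "m = Inf W"
  have "W \<noteq> {}" using x xy unfolding W_def by blast
  have bdd: "bdd_below W"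
    using A(2) unfolding W_def nonneg_operator_def by (intro bdd_belowI[of _ 0]) fastforce
  have m: "m * (norm x)\<^sup>2 \<le> y \<bullet> x" if "(x, y) \<in> A" for x y
  proof (cases "x = 0")
    case False
    then have "m \<le> y \<bullet> x / (norm x)\<^sup>2" unfolding m_def W_def[symmetric]
      using that by (intro cInf_lower bdd) (auto simp: W_def)
    then show ?thesis using False by (simp add: field_simps)
  qed simp
  have "\<mu> \<in> resolvent_set A" if "\<mu> < m" for \<mu>
  proof -
    have "(m - \<mu>) * (norm x)\<^sup>2 \<le> (y - \<mu> *\<^sub>R x) \<bullet> x" if "(x, y) \<in> A" for x y
      using m[OF that] by (simp add: inner_diff_left power2_norm_eq_inner algebra_simps)
    then show ?thesis
      using self_adjoint_bounded_below_inverse[OF self_adjoint_shift[OF A(1)], of "m - \<mu>"] that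
      unfolding resolvent_set_def by (smt (verit) Pair_inject mem_Collect_eq)
  qed
  moreover have "m \<notin> resolvent_set A"
  proof
    assume "m \<in> resolvent_set A"
    then obtain R where R: "bounded_linear R"
      and eq: "{(x, y - m *\<^sub>R x) | x y. (x, y) \<in> A} = {(R z, z) | z. True}"
      unfolding resolvent_set_def by blast
    have RA: "(R z, z + m *\<^sub>R R z) \<in> A" for z
    proof -
      have "(R z, z) \<in> {(x, y - m *\<^sub>R x) | x y. (x, y) \<in> A}" unfolding eq by blast
      then obtain y where "(R z, y) \<in> A" "z = y - m *\<^sub>R R z" by blast
      then show ?thesis by (simp add: algebra_simps)
    qed
    interpret R: bounded_linear R by (rule R)
    interpret R: positive_operator R
    proof
      show "R x \<bullet> y = x \<bullet> R y" for x y
        using self_adjoint_symmetric[OF A(1) RA[of x] RA[of y]]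
        by (simp add: inner_add_left inner_add_right)
      show "0 \<le> R x \<bullet> x" for x
        using m[OF RA[of x]] by (simp add: inner_add_left inner_add_right power2_norm_eq_inner inner_commute)
    qed
    obtain K where K: "K > 0" "\<And>x. norm (R x) \<le> norm x * K" using R.pos_bounded by blast
    have "m + 1 / K \<le> w" if w: "w \<in> W" for w
    proof -
      obtain x y where xy: "(x, y) \<in> A" "x \<noteq> 0" "w = y \<bullet> x / (norm x)\<^sup>2"
        using w unfolding W_def by blast
      define z where "z = y - m *\<^sub>R x"
      have "(x, z) \<in> {(R z, z) | z. True}" unfolding eq[symmetric] z_def using xy by blast
      then have "x = R z" by blast
      then have "(norm x)\<^sup>2 \<le> K * (x \<bullet> z)"
        using R.norm_power2_le[of K z] K by (simp add: mult.commute)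
      also have "x \<bullet> z = y \<bullet> x - m * (norm x)\<^sup>2"
        by (simp add: z_def inner_diff_right power2_norm_eq_inner inner_commute)
      finally have "(m + 1 / K) * (norm x)\<^sup>2 \<le> y \<bullet> x" using K(1) by (simp add: field_simps)
      then show ?thesis using xy(2) by (simp add: xy(3) pos_le_divide_eq)
    qed
    then have "m + 1 / K \<le> m" unfolding m_def by (intro cInf_greatest) (use \<open>W \<noteq> {}\<close> in auto)
    then show False using K(1) by simp
  qed
  ultimately have "lambda1 A = m"
    unfolding lambda1_def spectrum_def by (intro Least_equality) (auto intro: leI)
  then show ?thesis using m[OF xy] by simp
qed simp

subsection \<open>Square roots of positive operators\<close>

text \<open>With \<open>Q = I - R\<close>, the iterates \<open>Y\<^sub>n\<close> of \<open>Y \<mapsto> (R + Y\<^sup>2)/2\<close> are polynomials in \<open>R\<close>. They are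
  majorized, together with their increments, by the scalar iterates \<open>y\<^sub>n\<close> for \<open>R = 1\<close>, so they
  converge in norm, and the limit \<open>Y\<close> yields \<open>(I - Y)\<^sup>2 = Q\<close>.\<close>

fun sqrt_iter :: "('h::real_inner \<Rightarrow> 'h) \<Rightarrow> nat \<Rightarrow> 'h \<Rightarrow> 'h" where
  "sqrt_iter R 0 x = 0"
| "sqrt_iter R (Suc n) x = (1/2) *\<^sub>R (R x + sqrt_iter R n (sqrt_iter R n x))"

fun sqrt_iter_bound :: "nat \<Rightarrow> real" where
  "sqrt_iter_bound 0 = 0"
| "sqrt_iter_bound (Suc n) = (1 + (sqrt_iter_bound n)\<^sup>2) / 2"

lemma sqrt_iter_bound_01: "0 \<le> sqrt_iter_bound n \<and> sqrt_iter_bound n \<le> 1"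
proof (induction n)
  case (Suc n)
  then have "(sqrt_iter_bound n)\<^sup>2 \<le> 1" by (simp add: power_le_one)
  then show ?case by simp
qed simp

text \<open>The increment is half the square of \<open>1 - sqrt_iter_bound n\<close>.\<close>

lemma sqrt_iter_bound_le_Suc: "sqrt_iter_bound n \<le> sqrt_iter_bound (Suc n)"
  using sum_squares_ge_zero[of "1 - sqrt_iter_bound n" 0]
  by (simp add: power2_eq_square algebra_simps)

lemma convergent_sqrt_iter_bound: "convergent sqrt_iter_bound"
proof -
  have "incseq sqrt_iter_bound" by (intro incseq_SucI sqrt_iter_bound_le_Suc)
  then show ?thesis using sqrt_iter_bound_01 by (metis convergentI incseq_convergent)
qed

lemma linear_sqrt_iter:
  assumes "linear R"
  shows "linear (sqrt_iter R n)"
proof (induction n)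
  case 0
  show ?case by (rule linearI) auto
next
  case (Suc n)
  show ?case by (rule linearI)
    (simp_all add: linear_add[OF Suc] linear_add[OF assms] linear_scale[OF Suc] linear_scale[OF assms]
      scaleR_add_right)
qed

lemma sqrt_iter_commute:
  assumes "linear S" "\<And>x. S (R x) = R (S x)"
  shows "S (sqrt_iter R n x) = sqrt_iter R n (S x)"
  by (induction n arbitrary: x) (simp_all add: linear_0 linear_add linear_scale assms)

lemma sqrt_iter_symmetric:
  assumes "\<And>x y. R x \<bullet> y = x \<bullet> R y"
  shows "sqrt_iter R n x \<bullet> y = x \<bullet> sqrt_iter R n y"
  by (induction n arbitrary: x y) (simp_all add: inner_add_left inner_add_right assms)

context
  fixes R :: "'h::real_inner \<Rightarrow> 'h"
  assumes lin: "linear R" and contr: "\<And>x. norm (R x) \<le> norm x"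
begin

lemma norm_sqrt_iter: "norm (sqrt_iter R n x) \<le> sqrt_iter_bound n * norm x"
proof (induction n arbitrary: x)
  case (Suc n)
  let ?b = "sqrt_iter_bound n"
  have "norm (R x + sqrt_iter R n (sqrt_iter R n x)) \<le> norm x + ?b * (?b * norm x)"
    by (intro order_trans[OF norm_triangle_ineq] add_mono contr order_trans[OF Suc]
        mult_left_mono Suc) (simp add: sqrt_iter_bound_01)
  then show ?case unfolding sqrt_iter.simps norm_scaleR by (simp add: power2_eq_square algebra_simps)
qed simp

text \<open>Consecutive iterates commute, so \<open>Z\<^sup>2 - Y\<^sup>2 = (Z + Y) (Z - Y)\<close>.
  The scalar iterates factor in the same way, and the bounds on the two factors multiply to exactly
  the next scalar increment.\<close>

lemma norm_sqrt_iter_Suc_diff: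
  "norm (sqrt_iter R (Suc n) x - sqrt_iter R n x)
    \<le> (sqrt_iter_bound (Suc n) - sqrt_iter_bound n) * norm x"
proof (induction n arbitrary: x)
  case 0
  show ?case using contr[of x] by simp
next
  case (Suc n)
  let ?Y = "sqrt_iter R n" and ?Z = "sqrt_iter R (Suc n)"
  let ?y = "sqrt_iter_bound n" and ?z = "sqrt_iter_bound (Suc n)"
  note Y = linear_sqrt_iter[OF lin, of n] and Z = linear_sqrt_iter[OF lin, of "Suc n"]
  have comm: "?Z (?Y x) = ?Y (?Z x)"
    by (intro sqrt_iter_commute[OF Z] sqrt_iter_commute[OF lin, symmetric] refl)
  let ?d = "?Z x - ?Y x"
  have "sqrt_iter R (Suc (Suc n)) x - ?Z x
      = (1/2) *\<^sub>R (R x + ?Z (?Z x)) - (1/2) *\<^sub>R (R x + ?Y (?Y x))"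
    by (rule arg_cong2[OF sqrt_iter.simps(2) sqrt_iter.simps(2)])
  also have "\<dots> = (1/2) *\<^sub>R (?Z (?Z x) - ?Y (?Y x))"
    by (simp del: sqrt_iter.simps add: algebra_simps)
  also have "?Z (?Z x) - ?Y (?Y x) = ?Z ?d + ?Y ?d"
    by (simp add: linear_diff[OF Y] linear_diff[OF Z] comm del: sqrt_iter.simps)
  also have "norm ((1/2) *\<^sub>R (?Z ?d + ?Y ?d)) \<le> (1/2) * (?z * norm ?d + ?y * norm ?d)"
    using norm_triangle_ineq[of "?Z ?d" "?Y ?d"] norm_sqrt_iter[of "Suc n" ?d] norm_sqrt_iter[of n ?d]
    by (simp del: sqrt_iter.simps sqrt_iter_bound.simps)
  also have "\<dots> = (1/2) * (?z + ?y) * norm ?d" by (simp add: algebra_simps del: sqrt_iter.simps sqrt_iter_bound.simps)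
  also have "\<dots> \<le> (1/2) * (?z + ?y) * ((?z - ?y) * norm x)"
    by (intro mult_left_mono Suc) (use sqrt_iter_bound_01[of n] sqrt_iter_bound_01[of "Suc n"] in auto)
  also have "\<dots> = ((1 + ?z\<^sup>2) / 2 - (1 + ?y\<^sup>2) / 2) * norm x"
    by (simp del: sqrt_iter_bound.simps add: field_simps power2_eq_square)
  also have "(1 + ?z\<^sup>2) / 2 - (1 + ?y\<^sup>2) / 2 = sqrt_iter_bound (Suc (Suc n)) - ?z"
    by (rule arg_cong2[OF sqrt_iter_bound.simps(2) sqrt_iter_bound.simps(2), symmetric])
  finally show ?case .
qed

lemma norm_sqrt_iter_diff:
  "n \<le> m \<Longrightarrow> norm (sqrt_iter R m x - sqrt_iter R n x) \<le> (sqrt_iter_bound m - sqrt_iter_bound n) * norm x"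
proof (induction m rule: dec_induct)
  case (step m)
  then show ?case
    using norm_sqrt_iter_Suc_diff[of m x]
      norm_triangle_ineq[of "sqrt_iter R (Suc m) x - sqrt_iter R m x" "sqrt_iter R m x - sqrt_iter R n x"]
    by (simp del: sqrt_iter.simps sqrt_iter_bound.simps add: algebra_simps)
qed simp

end

section \<open>The limit of the iteration\<close>

definition sqrt_lim :: "('h::real_inner \<Rightarrow> 'h) \<Rightarrow> 'h \<Rightarrow> 'h" where
  "sqrt_lim R x = lim (\<lambda>n. sqrt_iter R n x)"

context
  fixes R :: "'h::{real_inner, complete_space} \<Rightarrow> 'h"
  assumes lin: "linear R" and contr: "\<And>x. norm (R x) \<le> norm x"
begin

lemma sqrt_iter_tendsto: "(\<lambda>n. sqrt_iter R n x) \<longlonglongrightarrow> sqrt_lim R x"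
proof -
  let ?Y = "\<lambda>n. sqrt_iter R n x"
  have "Cauchy ?Y"
  proof (rule CauchyI)
    fix e :: real assume "e > 0"
    have "Cauchy (\<lambda>n. sqrt_iter_bound n * norm x)"
      by (intro convergent_Cauchy convergent_mult convergent_sqrt_iter_bound convergent_const)
    with \<open>e > 0\<close> obtain N where
      N: "\<And>m n. m \<ge> N \<Longrightarrow> n \<ge> N \<Longrightarrow> \<bar>sqrt_iter_bound m * norm x - sqrt_iter_bound n * norm x\<bar> < e"
      by (metis CauchyD real_norm_def)
    have "norm (?Y m - ?Y n) < e" if "m \<ge> N" "n \<ge> N" for m n
    proof (cases "n \<le> m")
      case True
      then show ?thesis using norm_sqrt_iter_diff[OF lin contr True, of x] N[OF that]
        by (simp add: left_diff_distrib)
    next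
      case False
      then have "m \<le> n" by simp
      then show ?thesis using norm_sqrt_iter_diff[OF lin contr \<open>m \<le> n\<close>, of x] N[OF that]
        by (simp add: left_diff_distrib norm_minus_commute)
    qed
    then show "\<exists>M. \<forall>m\<ge>M. \<forall>n\<ge>M. norm (?Y m - ?Y n) < e" by blast
  qed
  then show ?thesis unfolding sqrt_lim_def using Cauchy_convergent convergent_LIMSEQ_iff by blast
qed

lemma linear_sqrt_lim: "linear (sqrt_lim R)"
proof (rule linearI)
  note L = linear_sqrt_iter[OF lin]
  show "sqrt_lim R (x + y) = sqrt_lim R x + sqrt_lim R y" for x y
    using tendsto_add[OF sqrt_iter_tendsto sqrt_iter_tendsto, of x y] sqrt_iter_tendsto[of "x + y"]
    by (simp add: linear_add[OF L] LIMSEQ_unique)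
  show "sqrt_lim R (r *\<^sub>R x) = r *\<^sub>R sqrt_lim R x" for r x
    using tendsto_scaleR[OF tendsto_const sqrt_iter_tendsto, of r x] sqrt_iter_tendsto[of "r *\<^sub>R x"]
    by (simp add: linear_scale[OF L] LIMSEQ_unique)
qed

lemma norm_sqrt_lim: "norm (sqrt_lim R x) \<le> norm x"
proof (rule LIMSEQ_le_const2)
  show "(\<lambda>n. norm (sqrt_iter R n x)) \<longlonglongrightarrow> norm (sqrt_lim R x)"
    by (intro tendsto_norm sqrt_iter_tendsto)
  have "norm (sqrt_iter R n x) \<le> norm x" for n
    using norm_sqrt_iter[OF lin contr, of n x] mult_right_mono[of "sqrt_iter_bound n" 1 "norm x"]
      sqrt_iter_bound_01[of n] by simp
  then show "\<exists>N. \<forall>n\<ge>N. norm (sqrt_iter R n x) \<le> norm x" by blast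
qed

lemma sqrt_lim_fixpoint: "sqrt_lim R x = (1/2) *\<^sub>R (R x + sqrt_lim R (sqrt_lim R x))"
proof (rule LIMSEQ_unique)
  show "(\<lambda>n. sqrt_iter R (Suc n) x) \<longlonglongrightarrow> sqrt_lim R x" by (rule LIMSEQ_Suc[OF sqrt_iter_tendsto])
  \<comment> \<open>Operator and argument vary together; since all iterates are contractions,
    replacing the inner argument by its limit costs at most the distance to that limit.\<close>
  have "(\<lambda>n. sqrt_iter R n (sqrt_iter R n x) - sqrt_iter R n (sqrt_lim R x)) \<longlonglongrightarrow> 0"
  proof (rule tendsto_norm_zero_cancel, rule tendsto_sandwich[OF _ _ tendsto_const])
    have "norm (sqrt_iter R n y) \<le> norm y" for n y
      using norm_sqrt_iter[OF lin contr, of n y] mult_right_mono[of "sqrt_iter_bound n" 1 "norm y"]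
        sqrt_iter_bound_01[of n] by simp
    then show "\<forall>\<^sub>F n in sequentially. norm (sqrt_iter R n (sqrt_iter R n x) - sqrt_iter R n (sqrt_lim R x))
        \<le> norm (sqrt_iter R n x - sqrt_lim R x)"
      by (auto intro!: always_eventually simp: linear_diff[OF linear_sqrt_iter[OF lin], symmetric])
    show "(\<lambda>n. norm (sqrt_iter R n x - sqrt_lim R x)) \<longlonglongrightarrow> 0"
      using sqrt_iter_tendsto[of x] by (simp add: tendsto_norm_zero LIM_zero)
  qed auto
  from tendsto_add[OF this sqrt_iter_tendsto[of "sqrt_lim R x"]]
  have "(\<lambda>n. sqrt_iter R n (sqrt_iter R n x)) \<longlonglongrightarrow> sqrt_lim R (sqrt_lim R x)" by simp
  then show "(\<lambda>n. sqrt_iter R (Suc n) x) \<longlonglongrightarrow> (1/2) *\<^sub>R (R x + sqrt_lim R (sqrt_lim R x))"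
    by (auto intro!: tendsto_intros)
qed

text \<open>Commutation with polynomials in \<open>R\<close> survives the limit. It yields the
  commutation clause of \<open>positive_operator_sqrt\<close>, on which uniqueness of the root
  rests.\<close>

lemma sqrt_lim_commute:
  assumes "bounded_linear S" "\<And>x. S (R x) = R (S x)"
  shows "S (sqrt_lim R x) = sqrt_lim R (S x)"
proof (rule LIMSEQ_unique)
  show "(\<lambda>n. S (sqrt_iter R n x)) \<longlonglongrightarrow> S (sqrt_lim R x)"
    by (rule bounded_linear.tendsto[OF assms(1) sqrt_iter_tendsto])
  show "(\<lambda>n. S (sqrt_iter R n x)) \<longlonglongrightarrow> sqrt_lim R (S x)"
  proof -
    have "S (sqrt_iter R n x) = sqrt_iter R n (S x)" for n
      by (intro sqrt_iter_commute bounded_linear.linear assms)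
    then show ?thesis using sqrt_iter_tendsto by simp
  qed
qed

lemma sqrt_lim_symmetric:
  assumes "\<And>x y. R x \<bullet> y = x \<bullet> R y"
  shows "sqrt_lim R x \<bullet> y = x \<bullet> sqrt_lim R y"
proof (rule LIMSEQ_unique)
  show "(\<lambda>n. sqrt_iter R n x \<bullet> y) \<longlonglongrightarrow> sqrt_lim R x \<bullet> y"
    by (intro tendsto_intros sqrt_iter_tendsto)
  show "(\<lambda>n. sqrt_iter R n x \<bullet> y) \<longlonglongrightarrow> x \<bullet> sqrt_lim R y"
    unfolding sqrt_iter_symmetric[OF assms] by (intro tendsto_intros sqrt_iter_tendsto)
qed

end

text \<open>Scaling by an operator bound \<open>K\<close> makes \<open>R = I - B / K\<close> a
  contraction, so the iteration applies; the factor \<open>sqrt K\<close> in \<open>T\<close> undoes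
  the scaling.\<close>

lemma positive_operator_sqrt:
  fixes B :: "'h::{real_inner, complete_space} \<Rightarrow> 'h"
  assumes "positive_operator B"
  obtains T where "positive_operator T" "\<And>x. T (T x) = B x"
    "\<And>S x. bounded_linear S \<Longrightarrow> (\<And>x. S (B x) = B (S x)) \<Longrightarrow> S (T x) = T (S x)"
proof -
  interpret B: positive_operator B by fact
  obtain K where K: "K > 0" "\<And>x. norm (B x) \<le> norm x * K" using B.pos_bounded by blast
  define R where "R x = x - (1 / K) *\<^sub>R B x" for x
  have linR: "linear R"
    by (rule linearI) (simp_all add: R_def B.add B.scaleR algebra_simps)
  \<comment> \<open>By \<open>norm_power2_le\<close> the quadratic term is at most half the linear
    one, so the expansion stays below the square of \<open>norm x\<close>.\<close>
  have contrR: "norm (R x) \<le> norm x" for x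
  proof (rule power2_le_imp_le)
    have "(norm (R x))\<^sup>2 = (norm x)\<^sup>2 - 2 / K * (B x \<bullet> x) + (norm (B x))\<^sup>2 / K\<^sup>2"
      unfolding R_def power2_norm_eq_inner inner_diff_left inner_diff_right
      by (simp add: inner_commute power2_eq_square algebra_simps)
    also have "\<dots> \<le> (norm x)\<^sup>2 - 2 / K * (B x \<bullet> x) + K * (B x \<bullet> x) / K\<^sup>2"
      using B.norm_power2_le[of K x] K by (simp add: divide_right_mono mult.commute)
    also have "\<dots> = (norm x)\<^sup>2 - (B x \<bullet> x) / K" using K(1) by (simp add: field_simps power2_eq_square)
    also have "\<dots> \<le> (norm x)\<^sup>2" using B.pos[of x] K(1) by simp
    finally show "(norm (R x))\<^sup>2 \<le> (norm x)\<^sup>2" .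
  qed simp
  have symR: "R x \<bullet> y = x \<bullet> R y" for x y
    by (simp add: R_def inner_diff_left inner_diff_right B.sym)
  define Y where "Y = sqrt_lim R"
  note linY = linear_sqrt_lim[OF linR contrR, folded Y_def]
    and normY = norm_sqrt_lim[OF linR contrR, folded Y_def]
    and fixY = sqrt_lim_fixpoint[OF linR contrR, folded Y_def]
    and commY = sqrt_lim_commute[OF linR contrR, folded Y_def]
    and symY = sqrt_lim_symmetric[OF linR contrR symR, folded Y_def]
  define T where "T x = sqrt K *\<^sub>R (x - Y x)" for x
  show thesis
  proof (rule that[of T])
    show "positive_operator T"
    proof
      show "T (x + y) = T x + T y" for x y by (simp add: T_def linear_add[OF linY] algebra_simps)
      show "T (r *\<^sub>R x) = r *\<^sub>R T x" for r x by (simp add: T_def linear_scale[OF linY] algebra_simps)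
      have "norm (T x) \<le> norm x * (sqrt K * 2)" for x
        using norm_triangle_ineq4[of x "Y x"] normY[of x] K(1) by (simp add: T_def)
      then show "\<exists>K. \<forall>x. norm (T x) \<le> norm x * K" by blast
      show "T x \<bullet> y = x \<bullet> T y" for x y
        by (simp add: T_def inner_diff_left inner_diff_right symY)
      \<comment> \<open>\<open>I - Y\<close> is positive because the limit \<open>Y\<close> is a
        contraction.\<close>
      show "0 \<le> T x \<bullet> x" for x
      proof -
        have "Y x \<bullet> x \<le> norm x * norm x"
          by (rule order_trans[OF norm_cauchy_schwarz mult_right_mono[OF normY]]) simp
        then show ?thesis using K(1) by (simp add: T_def inner_diff_left dot_square_norm power2_eq_square)
      qed
    qed
    show "T (T x) = B x" for x
    proof -
      \<comment> \<open>The fixed point equation says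
        \<open>(I - Y)\<^sup>2 = I - 2 Y + Y\<^sup>2 = I - R = B / K\<close>.\<close>
      have "2 *\<^sub>R Y x = R x + Y (Y x)" by (subst fixY) simp
      then have "x - Y x - (Y x - Y (Y x)) = (1 / K) *\<^sub>R B x"
        by (simp add: R_def scaleR_2 algebra_simps)
      moreover have "T (T x) = K *\<^sub>R (x - Y x - (Y x - Y (Y x)))"
        using K(1) by (simp add: T_def linear_scale[OF linY] linear_diff[OF linY] scaleR_diff_right)
      ultimately show ?thesis using K(1) by simp
    qed
    show "S (T x) = T (S x)" if S: "bounded_linear S" "\<And>x. S (B x) = B (S x)" for S x
    proof -
      interpret S: bounded_linear S by fact
      have "S (Y x) = Y (S x)" by (rule commY[OF S(1)]) (simp add: R_def S.diff S.scaleR S(2))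
      then show ?thesis by (simp add: T_def S.diff S.scaleR)
    qed
  qed
qed

text \<open>The difference \<open>d\<close> is annihilated by \<open>T + S\<close>, since
  \<open>(T + S) (T - S) x = 0\<close>. Pairing with \<open>d\<close> gives two nonnegative numbers
  with sum 0, so \<open>T d = 0\<close>.\<close>

lemma positive_operator_sqrt_unique:
  assumes "positive_operator T" "positive_operator S"
    and comm: "S (T x) = T (S x)" and eq: "T (T x) = S (S x)" and inj: "\<And>y. T y = 0 \<Longrightarrow> y = 0"
  shows "S x = T x"
proof -
  interpret T: positive_operator T by fact
  interpret S: positive_operator S by fact
  define d where "d = T x - S x"
  have "T d + S d = 0" by (simp add: d_def T.diff S.diff comm eq)
  then have "T d \<bullet> d + S d \<bullet> d = 0" by (metis inner_add_left inner_zero_left)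
  then have "T d \<bullet> d = 0" using T.pos[of d] S.pos[of d] by linarith
  then have "d = 0" by (rule inj[OF T.eq_0])
  then show ?thesis by (simp add: d_def)
qed

subsection \<open>The square root of the unbounded operator and the dual of its domain\<close>

lemma op_app_eq: "(x, y) \<in> G \<Longrightarrow> (\<And>z. (x, z) \<in> G \<Longrightarrow> z = y) \<Longrightarrow> op_app G x = y"
  unfolding op_app_def by (rule the_equality)

text \<open>\<open>T\<close> is the positive root of the bounded inverse \<open>B\<close> of
  \<open>A\<close>, and its inverse graph is the only candidate for \<open>sqrt_op A\<close>: any
  competitor \<open>S'\<close> has a bounded positive inverse \<open>Q\<close> with
  \<open>Q\<^sup>2 = B\<close>, and bounded positive roots are unique.\<close>

lemma sqrt_op_inverse:
  fixes A :: "'h::{real_inner, complete_space} operator"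
  assumes A: "self_adjoint A" and \<alpha>: "\<alpha> > 0"
    and lower: "\<And>x y. (x, y) \<in> A \<Longrightarrow> \<alpha> * (norm x)\<^sup>2 \<le> y \<bullet> x"
  obtains T where "positive_operator T" "\<And>x. T x = 0 \<Longrightarrow> x = 0" "closure (range T) = UNIV"
    "\<And>x. (norm (T x))\<^sup>2 \<le> (1 / \<alpha>) * (norm x)\<^sup>2" "sqrt_op A = {(T z, z) | z. True}"
proof -
  note A' = self_adjointD[OF A]
  obtain B where B: "bounded_linear B" "A = {(B z, z) | z. True}"
    using self_adjoint_bounded_below_inverse[OF A \<alpha> lower] by blast
  have BA: "(B z, z) \<in> A" for z using B by blast
  interpret B: bounded_linear B by (rule B)
  interpret B: positive_operator B
  proof
    show "B x \<bullet> y = x \<bullet> B y" for x y using self_adjoint_symmetric[OF A BA BA, of x y] by simp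
    show "0 \<le> B x \<bullet> x" for x
      using order_trans[OF _ lower[OF BA[of x]]] \<alpha> by (simp add: inner_commute)
  qed
  have injB: "x = 0" if "B x = 0" for x
    using that A'(3)[of 0 x 0] BA[of x] subspace_0[OF A'(1)] by (simp add: zero_prod_def)
  obtain T where T: "positive_operator T" "\<And>x. T (T x) = B x"
    "\<And>S x. bounded_linear S \<Longrightarrow> (\<And>x. S (B x) = B (S x)) \<Longrightarrow> S (T x) = T (S x)"
    using positive_operator_sqrt[OF B.positive_operator_axioms] by blast
  interpret T: positive_operator T by (rule T)
  have injT: "x = 0" if "T x = 0" for x
    using T(2)[of x] that injB by (simp add: T.zero)
  \<comment> \<open>The dense domain of \<open>A\<close> is the range of
    \<open>B = T\<^sup>2\<close>, hence lies in the range of \<open>T\<close>.\<close>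
  have dense: "closure (range T) = UNIV"
  proof -
    have "Domain A \<subseteq> range T" using B(2) T(2) by (auto simp: image_iff) metis
    then show ?thesis using closure_mono A'(2) by blast
  qed
  \<comment> \<open>Coercivity bounds \<open>B\<close> by \<open>1 / \<alpha>\<close>, and the
    square of the norm of \<open>T x\<close> is \<open>B x \<bullet> x\<close>.\<close>
  have normT: "(norm (T x))\<^sup>2 \<le> (1 / \<alpha>) * (norm x)\<^sup>2" for x
  proof -
    have "\<alpha> * norm (B x) * norm (B x) \<le> norm x * norm (B x)"
      using lower[OF BA[of x]] norm_cauchy_schwarz[of x "B x"] by (simp add: power2_eq_square)
    then have "\<alpha> * norm (B x) \<le> norm x" by (cases "B x = 0") auto
    then have *: "norm (B x) \<le> (1 / \<alpha>) * norm x" using \<alpha> by (simp add: field_simps)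
    have "(norm (T x))\<^sup>2 = B x \<bullet> x" by (simp add: power2_norm_eq_inner T.sym T(2) inner_commute[of x])
    also have "\<dots> \<le> norm (B x) * norm x" by (rule norm_cauchy_schwarz)
    also have "\<dots> \<le> ((1 / \<alpha>) * norm x) * norm x" by (intro mult_right_mono *) simp
    finally show ?thesis by (simp add: power2_eq_square)
  qed
  define S where "S = {(T z, z) | z. True}"
  have "sqrt_op A = S"
    unfolding sqrt_op_def
  proof (rule the_equality, intro conjI)
    have "subspace S"
      unfolding subspace_def S_def
      by (auto simp: zero_prod_def T.zero T.add T.scaleR intro: exI[of _ 0])
    moreover have "single_valued S"
    proof -
      have "y = z" if "T y = T z" for y z using injT[of "y - z"] that by (simp add: T.diff)
      then show ?thesis by (auto simp: single_valued_def S_def)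
    qed
    moreover have "Domain S = range T" unfolding S_def by blast
    moreover have "op_adjoint S = S"
    proof -
      have "(\<forall>(x, w)\<in>S. w \<bullet> y = x \<bullet> z) \<longleftrightarrow> y = T z" for y z
      proof -
        have "(\<forall>(x, w)\<in>S. w \<bullet> y = x \<bullet> z) \<longleftrightarrow> (\<forall>w. w \<bullet> y = w \<bullet> T z)"
          unfolding S_def by (auto simp: T.sym)
        also have "\<dots> \<longleftrightarrow> y = T z" by (rule vector_eq_ldot)
        finally show ?thesis .
      qed
      then show ?thesis unfolding op_adjoint_def by (auto simp: S_def)
    qed
    ultimately show "self_adjoint S"
      unfolding self_adjoint_def linear_operator_def using dense by simp
    show "nonneg_operator S"
      unfolding nonneg_operator_def S_def using T.pos by (auto simp: inner_commute)
    show "S O S = A" unfolding B(2) S_def using T(2) by (auto simp: relcomp_unfold)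
  next
    fix S' assume S': "self_adjoint S' \<and> nonneg_operator S' \<and> S' O S' = A"
    note D = self_adjointD[OF conjunct1[OF S']]
    \<comment> \<open>Since \<open>A = S' O S'\<close>, the pair \<open>(B y, y)\<close> factors
      through an intermediate element \<open>Q y\<close>; this defines the inverse of
      \<open>S'\<close>.\<close>
    have "\<exists>b. (B y, b) \<in> S' \<and> (b, y) \<in> S'" for y using S' BA[of y] by blast
    then obtain Q where Q: "\<And>y. (B y, Q y) \<in> S'" "\<And>y. (Q y, y) \<in> S'" by metis
    have ker: "b = 0" if "(b, 0) \<in> S'" for b
    proof -
      have "(0, 0) \<in> S'" using subspace_0[OF D(1)] by (simp add: zero_prod_def)
      with that have "(b, 0) \<in> A" using S' by blast
      then show ?thesis using B(2) by (auto simp: B.zero)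
    qed
    have uniq: "b = Q y" if "(b, y) \<in> S'" for b y
      using ker[of "b - Q y"] subspace_diff[OF D(1) that Q(2)[of y]] by simp
    have QQ: "Q (Q y) = B y" for y using uniq[OF Q(1)] by simp
    have symQ: "Q x \<bullet> y = x \<bullet> Q y" for x y
      using self_adjoint_symmetric[OF conjunct1[OF S'] Q(2) Q(2), of x y] by simp
    have Q_op: "positive_operator Q"
    proof
      show "Q (x + y) = Q x + Q y" for x y
        using uniq[of "Q x + Q y" "x + y"] subspace_add[OF D(1) Q(2) Q(2), of x y] by simp
      show "Q (r *\<^sub>R x) = r *\<^sub>R Q x" for r x
        using uniq[of "r *\<^sub>R Q x" "r *\<^sub>R x"] subspace_scale[OF D(1) Q(2), of r x] by simp
      show "Q x \<bullet> y = x \<bullet> Q y" for x y by (rule symQ)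
      show "0 \<le> Q x \<bullet> x" for x
        using S' Q(2)[of x] unfolding nonneg_operator_def by (fastforce simp: inner_commute)
      have "norm (Q x) = norm (T x)" for x
        by (simp add: norm_eq_sqrt_inner symQ T.sym QQ T(2))
      then show "\<exists>K. \<forall>x. norm (Q x) \<le> norm x * K" using T.bounded by simp
    qed
    interpret Q: positive_operator Q by (rule Q_op)
    \<comment> \<open>\<open>Q\<close> commutes with its own square \<open>B\<close>, hence with
      \<open>T\<close>.\<close>
    have comm: "Q (T x) = T (Q x)" for x
      by (rule T(3)) (auto simp: Q.bounded_linear_axioms simp flip: QQ)
    have "Q x = T x" for x
      by (rule positive_operator_sqrt_unique[OF T(1) Q_op comm _ injT]) (simp add: QQ T(2))
    then show "S' = S" unfolding S_def using Q(2) uniq by force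
  qed
  then show thesis using that[OF T(1) injT dense normT] S_def by simp
qed

section \<open>The spaces V and V' in terms of \<open>T\<close>\<close>

locale inverse_sqrt = positive_operator T
  for T :: "'h::real_inner \<Rightarrow> 'h" and A :: "'h operator" +
  assumes injective: "T x = 0 \<Longrightarrow> x = 0"
    and sqrt_op: "sqrt_op A = {(T z, z) | z. True}"
begin

lemma op_app_sqrt_op: "op_app (sqrt_op A) (T z) = z"
proof (rule op_app_eq)
  show "(T z, z) \<in> sqrt_op A" unfolding sqrt_op by blast
  fix y assume "(T z, y) \<in> sqrt_op A"
  then have "T (y - z) = 0" unfolding sqrt_op by (simp add: diff)
  then show "y = z" using injective[of "y - z"] by simp
qed

lemma V_space: "V_space A = range T"
  unfolding V_space_def sqrt_op by blast

lemma V_norm: "V_norm A (T z) = norm z"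
  by (simp add: V_norm_def op_app_sqrt_op)

text \<open>\<open>T\<close> maps H isometrically onto V, so pulling a functional back along
  \<open>T\<close> turns its dual norm into the norm of its Riesz representative; the supremum is
  attained at \<open>sgn h\<close>.\<close>

lemma dual_norm:
  assumes f: "\<And>z. f (T z) = h \<bullet> z"
  shows "dual_norm A f = norm h"
proof -
  have ball: "{w \<in> V_space A. V_norm A w \<le> 1} = T ` cball 0 1"
    by (auto simp: V_space V_norm)
  have "dual_norm A f = (SUP z \<in> cball 0 1. \<bar>h \<bullet> z\<bar>)"
    unfolding dual_norm_def ball image_image f ..
  also have "\<dots> = norm h"
  proof (rule cSup_eq_maximum)
    show "norm h \<in> (\<lambda>z. \<bar>h \<bullet> z\<bar>) ` cball 0 1"
    proof (rule image_eqI)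
      show "norm h = \<bar>h \<bullet> sgn h\<bar>"
        by (cases "h = 0") (auto simp: sgn_div_norm dot_square_norm power2_eq_square)
      show "sgn h \<in> cball 0 1" by (simp add: norm_sgn)
    qed
    fix r assume "r \<in> (\<lambda>z. \<bar>h \<bullet> z\<bar>) ` cball 0 1"
    then obtain z where z: "r = \<bar>h \<bullet> z\<bar>" "norm z \<le> 1" by auto
    have "\<bar>h \<bullet> z\<bar> \<le> norm h * norm z" by (rule Cauchy_Schwarz_ineq2)
    also have "\<dots> \<le> norm h" using z by (simp add: mult_left_le)
    finally show "r \<le> norm h" using z by simp
  qed
  finally show ?thesis .
qed

lemma dual_norm_H: "dual_norm A (H_to_dual A h) = norm (T h)"
  by (rule dual_norm) (simp add: H_to_dual_def V_space sym)

lemma weak_regularity_V: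
  assumes "weak_regularity A u u1 u2" "t \<ge> 0"
  shows "T (op_app (sqrt_op A) (u t)) = u t"
  using assms unfolding weak_regularity_def continuous_into_V_def V_space
  by (auto simp: op_app_sqrt_op)

text \<open>Differentiability in \<open>V'\<close> is differentiability in \<open>H\<close> after application of \<open>A\<^sup>-\<^sup>1\<^sup>/\<^sup>2\<close>.\<close>

lemma weak_regularity_derivative:
  assumes reg: "weak_regularity A u u1 u2" and t: "t \<ge> 0" and g: "\<And>z. u2 t (T z) = g \<bullet> z"
  shows "((\<lambda>s. T (u1 s)) has_vector_derivative g) (at t within {0..})"
proof -
  let ?q = "\<lambda>s w. (H_to_dual A (u1 s) w - H_to_dual A (u1 t) w) / (s - t) - u2 t w"
  have "dual_norm A (?q s) = norm ((1 / (s - t)) *\<^sub>R (T (u1 s) - T (u1 t)) - g)" for s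
    by (rule dual_norm) (simp add: H_to_dual_def V_space sym g inner_diff_left diff_divide_distrib)
  moreover have "((\<lambda>s. dual_norm A (?q s)) \<longlongrightarrow> 0) (at t within {0..})"
    using reg t unfolding weak_regularity_def has_derivative_in_dual_def by blast
  ultimately have lim: "((\<lambda>s. norm ((1 / (s - t)) *\<^sub>R (T (u1 s) - T (u1 t)) - g)) \<longlongrightarrow> 0)
      (at t within {0..})" by simp
  have eq: "norm ((1 / (s - t)) *\<^sub>R (T (u1 s) - T (u1 t)) - g)
      = norm (T (u1 s) - T (u1 t) - (s - t) *\<^sub>R g) / norm (s - t)" if "s \<noteq> t" for s
  proof -
    have "(1 / (s - t)) *\<^sub>R (T (u1 s) - T (u1 t)) - g
        = (1 / (s - t)) *\<^sub>R (T (u1 s) - T (u1 t) - (s - t) *\<^sub>R g)"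
      using that by (simp add: scaleR_diff_right)
    then show ?thesis by simp
  qed
  have "((\<lambda>s. norm (T (u1 s) - T (u1 t) - (s - t) *\<^sub>R g) / norm (s - t)) \<longlongrightarrow> 0) (at t within {0..})"
    using lim by (rule Lim_transform_eventually) (auto simp: eventually_at_filter eq)
  then show ?thesis
    unfolding has_vector_derivative_def has_derivative_iff_norm by (simp add: bounded_linear_scaleR_left)
qed

end

subsection \<open>The Lyapunov functional\<close>

lemma inner_young:
  fixes a b :: "'a::real_inner"
  assumes "d > 0"
  shows "\<bar>a \<bullet> b\<bar> \<le> d * (norm a)\<^sup>2 + (norm b)\<^sup>2 / (4 * d)"
proof -
  have "0 \<le> (2 * d * norm a - norm b)\<^sup>2 / (4 * d)" using assms by simp
  also have "\<dots> = d * (norm a)\<^sup>2 + (norm b)\<^sup>2 / (4 * d) - norm a * norm b"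
    using assms by (simp add: power2_eq_square field_simps)
  finally show ?thesis using Cauchy_Schwarz_ineq2[of a b] by linarith
qed

lemma inner_young_2:
  fixes a b :: "'a::real_inner"
  shows "2 * \<bar>a \<bullet> b\<bar> \<le> (norm a)\<^sup>2 + (norm b)\<^sup>2"
  using inner_young[of "1/2" a b] by (simp add: field_simps)

context positive_operator
begin

text \<open>For a pair (U, V) the arguments stand for
  \<open>x = A\<^sup>1\<^sup>/\<^sup>2 U\<close>, \<open>y = U'\<close>,
  \<open>z = A\<^sup>1\<^sup>/\<^sup>2 V\<close>, \<open>w = V'\<close>. Then \<open>T x = U\<close>
  and \<open>T z = V\<close>, so the last term is the coupling energy.\<close>

definition energy :: "real \<Rightarrow> 'h \<Rightarrow> 'h \<Rightarrow> 'h \<Rightarrow> 'h \<Rightarrow> real" where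
  "energy c x y z w = (x \<bullet> x + y \<bullet> y + z \<bullet> z + w \<bullet> w) / 2 + c * (T x \<bullet> T z)"

text \<open>In the same reading, with \<open>B = T\<^sup>2\<close>, the summands are
  \<open>(\<langle>U', V\<rangle> - \<langle>U, V'\<rangle>) / c\<close>,
  \<open>2 \<langle>U', B U\<rangle>\<close> and \<open>- \<eta> \<langle>V', B V\<rangle>\<close>;
  the last sign makes the square of \<open>V'\<close> in the dual norm appear negatively in the
  derivative.\<close>

definition correction :: "real \<Rightarrow> real \<Rightarrow> 'h \<Rightarrow> 'h \<Rightarrow> 'h \<Rightarrow> 'h \<Rightarrow> real" where
  "correction c \<eta> x y z w = (y \<bullet> T z - T x \<bullet> w) / c + 2 * (T y \<bullet> T (T x)) - \<eta> * (T w \<bullet> T (T z))"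

context
  fixes \<kappa> c k :: real
  assumes \<kappa>: "\<kappa> > 0" and bound: "\<And>x. (norm (T x))\<^sup>2 \<le> \<kappa> * (norm x)\<^sup>2"
    and c: "c \<noteq> 0" and k_def: "k = \<bar>c\<bar> * \<kappa>" and k1: "k < 1"
begin

lemma coupling_le: "\<bar>c * (T x \<bullet> T z)\<bar> \<le> k * ((norm x)\<^sup>2 + (norm z)\<^sup>2) / 2"
proof -
  have "\<bar>T x \<bullet> T z\<bar> \<le> (\<kappa> * (norm x)\<^sup>2 + \<kappa> * (norm z)\<^sup>2) / 2"
    using inner_young_2[of "T x" "T z"] bound[of x] bound[of z] by simp
  then have "\<bar>c\<bar> * \<bar>T x \<bullet> T z\<bar> \<le> \<bar>c\<bar> * ((\<kappa> * (norm x)\<^sup>2 + \<kappa> * (norm z)\<^sup>2) / 2)"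
    by (rule mult_left_mono) simp
  then show ?thesis by (simp add: k_def abs_mult algebra_simps)
qed

lemma k_nonneg: "k \<ge> 0" using \<kappa> by (simp add: k_def)

lemma energy_bounds:
  fixes x y z w :: 'h
  defines "s \<equiv> (norm x)\<^sup>2 + (norm y)\<^sup>2 + (norm z)\<^sup>2 + (norm w)\<^sup>2"
  shows "(1 - k) / 2 * s \<le> energy c x y z w" "energy c x y z w \<le> s"
proof -
  have "k * ((norm x)\<^sup>2 + (norm z)\<^sup>2) \<le> k * s"
    by (intro mult_left_mono k_nonneg) (simp add: s_def)
  with coupling_le[of x z] have *: "\<bar>c * (T x \<bullet> T z)\<bar> \<le> k * s / 2" by simp
  have e: "energy c x y z w = s / 2 + c * (T x \<bullet> T z)"
    by (simp add: energy_def s_def dot_square_norm)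
  show "(1 - k) / 2 * s \<le> energy c x y z w" unfolding e using * by (simp add: algebra_simps abs_le_iff)
  have "s \<ge> 0" by (simp add: s_def)
  then have "k * s \<le> s" using k1 by (simp add: mult_left_le_one_le k_nonneg)
  then show "energy c x y z w \<le> s" unfolding e using * by (simp add: abs_le_iff)
qed

lemma correction_le:
  fixes x y z w :: 'h
  assumes "0 \<le> \<eta>" "\<eta> \<le> 1"
  shows "\<bar>correction c \<eta> x y z w\<bar> \<le> ((1 + \<kappa>) / \<bar>c\<bar> + 3 * (\<kappa> + \<kappa>\<^sup>2))
    * ((norm x)\<^sup>2 + (norm y)\<^sup>2 + (norm z)\<^sup>2 + (norm w)\<^sup>2)" (is "_ \<le> _ * ?s")
proof -
  define s where "s = ?s"
  have \<kappa>s: "(norm a)\<^sup>2 \<le> s \<Longrightarrow> \<kappa> * (norm a)\<^sup>2 \<le> \<kappa> * s" for a :: 'h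
    using \<kappa> by (intro mult_left_mono) auto
  have T1: "(norm (T a))\<^sup>2 \<le> \<kappa> * s" if "(norm a)\<^sup>2 \<le> s" for a
    using bound[of a] \<kappa>s[OF that] by linarith
  have T2: "(norm (T (T a)))\<^sup>2 \<le> \<kappa>\<^sup>2 * s" if "(norm a)\<^sup>2 \<le> s" for a
  proof -
    have "(norm (T (T a)))\<^sup>2 \<le> \<kappa> * (norm (T a))\<^sup>2" by (rule bound)
    also have "\<dots> \<le> \<kappa> * (\<kappa> * s)" using T1[OF that] \<kappa> by (intro mult_left_mono) auto
    finally show ?thesis by (simp add: power2_eq_square)
  qed
  have s: "(norm x)\<^sup>2 \<le> s" "(norm y)\<^sup>2 \<le> s" "(norm z)\<^sup>2 \<le> s" "(norm w)\<^sup>2 \<le> s" by (auto simp: s_def)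
  have 1: "\<bar>y \<bullet> T z - T x \<bullet> w\<bar> \<le> (1 + \<kappa>) * s"
    using inner_young_2[of y "T z"] inner_young_2[of "T x" w] T1[OF s(1)] T1[OF s(3)] s(2,4)
    unfolding distrib_right[of 1] by linarith
  have 2: "\<bar>T y \<bullet> T (T x)\<bar> \<le> (\<kappa> + \<kappa>\<^sup>2) * s"
    using inner_young_2[of "T y" "T (T x)"] T1[OF s(2)] T2[OF s(1)]
    unfolding distrib_right[of \<kappa>] by linarith
  have 3: "\<bar>T w \<bullet> T (T z)\<bar> \<le> (\<kappa> + \<kappa>\<^sup>2) * s"
    using inner_young_2[of "T w" "T (T z)"] T1[OF s(4)] T2[OF s(3)]
    unfolding distrib_right[of \<kappa>] by linarith
  have "\<bar>correction c \<eta> x y z w\<bar>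
      \<le> \<bar>(y \<bullet> T z - T x \<bullet> w) / c\<bar> + 2 * \<bar>T y \<bullet> T (T x)\<bar> + \<bar>\<eta> * (T w \<bullet> T (T z))\<bar>"
    unfolding correction_def by linarith
  also have "\<bar>(y \<bullet> T z - T x \<bullet> w) / c\<bar> \<le> (1 + \<kappa>) * s / \<bar>c\<bar>"
    unfolding abs_divide by (intro divide_right_mono 1) simp
  also have "\<bar>\<eta> * (T w \<bullet> T (T z))\<bar> \<le> (\<kappa> + \<kappa>\<^sup>2) * s"
  proof -
    have "\<bar>\<eta> * (T w \<bullet> T (T z))\<bar> \<le> \<bar>T w \<bullet> T (T z)\<bar>"
      using assms by (simp add: abs_mult mult_left_le_one_le)
    then show ?thesis using 3 by linarith
  qed
  \<comment> \<open>The factor 3 collects the weight 2 of the second summand and the weight \<eta>,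
    at most 1, of the third.\<close>
  finally have "\<bar>correction c \<eta> x y z w\<bar> \<le> (1 + \<kappa>) * s / \<bar>c\<bar> + 3 * ((\<kappa> + \<kappa>\<^sup>2) * s)"
    using 2 by linarith
  then show ?thesis by (simp add: distrib_right s_def)
qed

text \<open>The left-hand side is the time derivative of \<open>correction\<close> along the system.\<close>

lemma dissipation:
  fixes x y z :: 'h
  assumes m: "m = 1 - k" and \<eta>: "\<eta> = m / 8"
  defines "N \<equiv> 2 / (m * c\<^sup>2) + 2 * \<kappa> + 8 * \<kappa>\<^sup>2 / m + \<kappa>"
  shows "(T x \<bullet> T x) - (T z \<bullet> T z) - (y \<bullet> T z) / c
      + 2 * (T y \<bullet> T y - T y \<bullet> T (T x) - T x \<bullet> T x - c * (T (T z) \<bullet> T (T x)))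
      - \<eta> * (T w \<bullet> T w - T z \<bullet> T z - c * (T (T x) \<bullet> T (T z)))
    \<le> N * (y \<bullet> y) - \<eta> * ((norm (T x))\<^sup>2 + (norm (T y))\<^sup>2 + (norm (T z))\<^sup>2 + (norm (T w))\<^sup>2)"
    (is "?lhs \<le> _")
proof -
  define X Y Z W n p where "X = (norm (T x))\<^sup>2" and "Y = (norm (T y))\<^sup>2" and "Z = (norm (T z))\<^sup>2"
    and "W = (norm (T w))\<^sup>2" and "n = (norm y)\<^sup>2" and "p = c * (T (T x) \<bullet> T (T z))"
  note defs = X_def Y_def Z_def W_def n_def p_def
  have mp: "0 < m" "m \<le> 1" using k1 k_nonneg m by auto
  have nn: "X \<ge> 0" "Y \<ge> 0" "Z \<ge> 0" "W \<ge> 0" "n \<ge> 0" by (auto simp: defs)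
  have p: "\<bar>p\<bar> \<le> k * (X + Z) / 2" unfolding defs by (rule coupling_le)
  \<comment> \<open>All coupling terms add up to \<open>- ((2 - \<eta>) * p)\<close>. They cost at
    most \<open>(1 - m) * (X + Z)\<close>, so \<open>m * (X + Z)\<close> of the dissipation
    survives.\<close>
  have "(2 - \<eta>) * \<bar>p\<bar> \<le> 2 * \<bar>p\<bar>" using mp \<eta> by (intro mult_right_mono) auto
  moreover have "- ((2 - \<eta>) * p) \<le> (2 - \<eta>) * \<bar>p\<bar>"
    using mp \<eta> mult_left_mono[of "-p" "\<bar>p\<bar>" "2 - \<eta>"] by simp
  ultimately have coupling: "- ((2 - \<eta>) * p) \<le> (1 - m) * (X + Z)" using p m by simp
  \<comment> \<open>The Young weight \<open>m / 8\<close> is \<eta>. Of the surviving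
    \<open>8 * \<eta>\<close>, the cross terms and \<open>\<eta> * Z\<close> consume one share of
    \<open>X\<close> and two of \<open>Z\<close>, which leaves the coefficients 7 and 6.\<close>
  have a: "- ((y \<bullet> T z) / c) \<le> m / 8 * Z + 2 / (m * c\<^sup>2) * n"
  proof -
    have "- ((y \<bullet> T z) / c) = T z \<bullet> ((- 1 / c) *\<^sub>R y)" by (simp add: inner_commute)
    also have "\<dots> \<le> m / 8 * Z + (norm ((- 1 / c) *\<^sub>R y))\<^sup>2 / (4 * (m / 8))"
      unfolding Z_def using inner_young[of "m / 8" "T z" "(- 1 / c) *\<^sub>R y"] mp by linarith
    also have "(norm ((- 1 / c) *\<^sub>R y))\<^sup>2 / (4 * (m / 8)) = 2 / (m * c\<^sup>2) * n"
      using c mp by (simp add: n_def power_mult_distrib power_divide field_simps)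
    finally show ?thesis .
  qed
  have Yn: "Y \<le> \<kappa> * n" unfolding defs by (rule bound)
  have b: "- 2 * (T y \<bullet> T (T x)) \<le> m / 8 * X + 8 * \<kappa>\<^sup>2 / m * n"
  proof -
    have "(norm (T (T y)))\<^sup>2 \<le> \<kappa> * Y" unfolding defs by (rule bound)
    also have "\<dots> \<le> \<kappa> * (\<kappa> * n)" using Yn \<kappa> by (intro mult_left_mono) auto
    finally have TTy: "(norm (T (T y)))\<^sup>2 \<le> \<kappa>\<^sup>2 * n" by (simp add: power2_eq_square)
    have "- 2 * (T y \<bullet> T (T x)) = T x \<bullet> (- 2 *\<^sub>R T (T y))"
      by (simp add: sym[of "T y" "T x", symmetric] inner_commute)
    also have "\<dots> \<le> m / 8 * X + (norm (- 2 *\<^sub>R T (T y)))\<^sup>2 / (4 * (m / 8))"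
      unfolding X_def using inner_young[of "m / 8" "T x" "- 2 *\<^sub>R T (T y)"] mp by linarith
    also have "(norm (- 2 *\<^sub>R T (T y)))\<^sup>2 / (4 * (m / 8)) = 8 / m * (norm (T (T y)))\<^sup>2"
      using mp by (simp add: power_mult_distrib field_simps)
    also have "\<dots> \<le> 8 / m * (\<kappa>\<^sup>2 * n)" using TTy mp by (intro mult_left_mono) auto
    finally show ?thesis by simp
  qed
  have "?lhs = X - Z - (y \<bullet> T z) / c + 2 * (Y - T y \<bullet> T (T x) - X - p) - \<eta> * (W - Z - p)"
    by (simp add: defs dot_square_norm inner_commute)
  also have "\<dots> = - X - Z - ((y \<bullet> T z) / c) + 2 * Y + (- 2 * (T y \<bullet> T (T x)))
      + (- ((2 - \<eta>) * p)) - \<eta> * W + \<eta> * Z" by (simp add: algebra_simps)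
  also have "\<dots> \<le> - X - Z + (m / 8 * Z + 2 / (m * c\<^sup>2) * n) + 2 * Y + (m / 8 * X + 8 * \<kappa>\<^sup>2 / m * n)
      + (1 - m) * (X + Z) - \<eta> * W + \<eta> * Z" using a b coupling by linarith
  also have "\<dots> = 2 / (m * c\<^sup>2) * n + 8 * \<kappa>\<^sup>2 / m * n + 2 * Y - \<eta> * (7 * X + 6 * Z + W)"
    by (simp add: \<eta> field_simps)
  \<comment> \<open>\<open>Y\<close> is charged to the damping through
    \<open>Y \<le> \<kappa> * n\<close>; the last summand \<kappa> of \<open>N\<close> pays for
    inserting \<open>- \<eta> * Y\<close>.\<close>
  also have "\<dots> \<le> 2 / (m * c\<^sup>2) * n + 8 * \<kappa>\<^sup>2 / m * n + (2 * (\<kappa> * n) + \<kappa> * n - \<eta> * Y) - \<eta> * (X + Z + W)"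
  proof -
    have "\<eta> * Y \<le> 1 * Y" using mp \<eta> nn by (intro mult_right_mono) auto
    moreover have "\<eta> * (X + Z + W) \<le> \<eta> * (7 * X + 6 * Z + W)" using mp \<eta> nn by (intro mult_left_mono) auto
    ultimately show ?thesis using Yn by linarith
  qed
  also have "\<dots> = N * n - \<eta> * (X + Y + Z + W)" by (simp add: N_def algebra_simps)
  finally show ?thesis by (simp add: defs dot_square_norm)
qed

end

section \<open>Derivatives along the system\<close>

lemmas inner_derivative = bounded_bilinear.has_vector_derivative[OF bounded_bilinear_inner]

lemma swap:
  "x \<bullet> T y = y \<bullet> T x" "x \<bullet> T (T y) = y \<bullet> T (T x)" "x \<bullet> T (T (T y)) = y \<bullet> T (T (T x))"
  "x \<bullet> T (T (T (T y))) = y \<bullet> T (T (T (T x)))"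
  "x \<bullet> T (T (T (T (T y)))) = y \<bullet> T (T (T (T (T x))))"
  "x \<bullet> T (T (T (T (T (T y))))) = y \<bullet> T (T (T (T (T (T x)))))"
  by (simp_all add: inner_commute[of x] sym)

text \<open>In the energy, \<open>x \<bullet> b = T a \<bullet> b\<close> cancels
  \<open>y \<bullet> a = T b \<bullet> a\<close> by symmetry, and likewise for \<open>d\<close> and
  \<open>e\<close>; the derivative of the coupling energy cancels the coupling forces. Only the
  damping remains.\<close>

lemma strong_derivatives:
  assumes x: "(x has_vector_derivative b) (at t within I)" and xa: "x t = T a"
    and y: "(y has_vector_derivative - y t - a - c *\<^sub>R T (z t)) (at t within I)" and yb: "y t = T b"
    and z: "(z has_vector_derivative e) (at t within I)" and zd: "z t = T d"
    and w: "(w has_vector_derivative - d - c *\<^sub>R T (x t)) (at t within I)" and we: "w t = T e"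
  shows "((\<lambda>s. energy c (x s) (y s) (z s) (w s)) has_vector_derivative - (y t \<bullet> y t)) (at t within I)"
    and "c \<noteq> 0 \<Longrightarrow> ((\<lambda>s. correction c \<eta> (x s) (y s) (z s) (w s)) has_vector_derivative
      ((T (x t) \<bullet> T (x t)) - (T (z t) \<bullet> T (z t)) - (y t \<bullet> T (z t)) / c
      + 2 * (T (y t) \<bullet> T (y t) - T (y t) \<bullet> T (T (x t)) - T (x t) \<bullet> T (x t)
          - c * (T (T (z t)) \<bullet> T (T (x t))))
      - \<eta> * (T (w t) \<bullet> T (w t) - T (z t) \<bullet> T (z t) - c * (T (T (x t)) \<bullet> T (T (z t)))))) (at t within I)"
proof -
  note rules = derivative_eq_intros inner_derivative has_vector_derivative x y z w refl
  \<comment> \<open>Normal form: everything is written in \<open>a\<close>, \<open>b\<close>,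
    \<open>d\<close>, \<open>e\<close>, all factors \<open>T\<close> move to the right, and the two
    arguments of each inner product are put in this order.\<close>
  note norm_form = xa yb zd we add diff neg scaleR zero inner_add_left inner_add_right inner_diff_left
    inner_diff_right sym swap[of b a] swap[of d a] swap[of e a] swap[of d b] swap[of e b] swap[of e d]
    inner_commute[of b a] inner_commute[of d a] inner_commute[of e a] inner_commute[of d b]
    inner_commute[of e b] inner_commute[of e d]
  show "((\<lambda>s. energy c (x s) (y s) (z s) (w s)) has_vector_derivative - (y t \<bullet> y t)) (at t within I)"
    unfolding energy_def by (rule rules)+ (simp add: norm_form field_simps)
  show "((\<lambda>s. correction c \<eta> (x s) (y s) (z s) (w s)) has_vector_derivative
      ((T (x t) \<bullet> T (x t)) - (T (z t) \<bullet> T (z t)) - (y t \<bullet> T (z t)) / c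
      + 2 * (T (y t) \<bullet> T (y t) - T (y t) \<bullet> T (T (x t)) - T (x t) \<bullet> T (x t)
          - c * (T (T (z t)) \<bullet> T (T (x t))))
      - \<eta> * (T (w t) \<bullet> T (w t) - T (z t) \<bullet> T (z t) - c * (T (T (x t)) \<bullet> T (T (z t)))))) (at t within I)"
    if "c \<noteq> 0"
  proof -
    \<comment> \<open>The velocity products and the terms coming from \<open>a\<close> and
      \<open>d\<close> cancel by symmetry, leaving coupling and damping.\<close>
    have 1: "((\<lambda>s. y s \<bullet> T (z s) - T (x s) \<bullet> w s) has_vector_derivative
        c * (T (x t) \<bullet> T (x t)) - c * (T (z t) \<bullet> T (z t)) - y t \<bullet> T (z t)) (at t within I)"
      by (rule rules)+ (simp add: norm_form)
    have 2: "((\<lambda>s. T (y s) \<bullet> T (T (x s))) has_vector_derivative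
        T (y t) \<bullet> T (y t) - T (y t) \<bullet> T (T (x t)) - T (x t) \<bullet> T (x t)
          - c * (T (T (z t)) \<bullet> T (T (x t)))) (at t within I)"
      by (rule has_vector_derivative_eq_rhs, (rule rules)+) (simp add: norm_form)
    have 3: "((\<lambda>s. T (w s) \<bullet> T (T (z s))) has_vector_derivative
        T (w t) \<bullet> T (w t) - T (z t) \<bullet> T (z t) - c * (T (T (x t)) \<bullet> T (T (z t)))) (at t within I)"
      by (rule has_vector_derivative_eq_rhs, (rule rules)+) (simp add: norm_form)
    show ?thesis
      unfolding correction_def
      by (rule derivative_eq_intros 1 2 3 refl)+ (simp add: that diff_divide_distrib)
  qed
qed

text \<open>For a weak solution \<open>(u, v)\<close> and a bounded operator \<open>R\<close> commuting with \<open>T = A\<^sup>-\<^sup>1\<^sup>/\<^sup>2\<close>, the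
  quadruple \<open>(R u, R T u', R v, R T v')\<close> is a strong solution in the following sense. Here \<open>energy\<close>
  is the natural energy of \<open>(T R u, T R v)\<close>.\<close>

definition strong_solution ::
    "real \<Rightarrow> (real \<Rightarrow> 'h) \<Rightarrow> (real \<Rightarrow> 'h) \<Rightarrow> (real \<Rightarrow> 'h) \<Rightarrow> (real \<Rightarrow> 'h) \<Rightarrow> bool" where
  "strong_solution c x y z w \<longleftrightarrow> (\<forall>t\<ge>0. \<exists>a b d e.
    x t = T a \<and> y t = T b \<and> z t = T d \<and> w t = T e \<and>
    (x has_vector_derivative b) (at t within {0..}) \<and>
    (y has_vector_derivative - y t - a - c *\<^sub>R T (z t)) (at t within {0..}) \<and>
    (z has_vector_derivative e) (at t within {0..}) \<and>
    (w has_vector_derivative - d - c *\<^sub>R T (x t)) (at t within {0..}))"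

text \<open>With \<open>F\<close> the energy of \<open>(T x, T y, T z, T w)\<close>, the function \<open>M * energy + correction + \<eta> * t * F\<close>
  is nonincreasing for large \<open>M\<close>, so \<open>t * F\<close> is bounded by the initial energy.\<close>

lemma strong_solution_decay:
  assumes \<kappa>: "\<kappa> > 0" and bound: "\<And>x. (norm (T x))\<^sup>2 \<le> \<kappa> * (norm x)\<^sup>2"
    and c: "c \<noteq> 0" and k1: "\<bar>c\<bar> * \<kappa> < 1"
  obtains C where "C > 0"
    "\<And>x y z w t. strong_solution c x y z w \<Longrightarrow> t > 0 \<Longrightarrow>
      (norm (T (x t)))\<^sup>2 + (norm (T (y t)))\<^sup>2 + (norm (T (z t)))\<^sup>2 + (norm (T (w t)))\<^sup>2
      \<le> C * (((norm (x 0))\<^sup>2 + (norm (y 0))\<^sup>2 + (norm (z 0))\<^sup>2 + (norm (w 0))\<^sup>2) / t)"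
proof -
  note a = \<kappa> bound c refl k1
  define m where "m = 1 - \<bar>c\<bar> * \<kappa>"
  define \<eta> where "\<eta> = m / 8"
  define N where "N = 2 / (m * c\<^sup>2) + 2 * \<kappa> + 8 * \<kappa>\<^sup>2 / m + \<kappa>"
  define K where "K = (1 + \<kappa>) / \<bar>c\<bar> + 3 * (\<kappa> + \<kappa>\<^sup>2)"
  \<comment> \<open>The part \<open>N\<close> absorbs the term \<open>N * (y \<bullet> y)\<close> of
    \<open>dissipation\<close>; the part \<open>2 * K / m\<close> makes the energy, at least
    \<open>m / 2\<close> times the squared norms, dominate the correction.\<close>
  define M where "M = N + 2 * K / m"
  have m: "m > 0" "m \<le> 1" using k1 \<kappa> by (auto simp: m_def)
  have pos': "N > 0" "K > 0" "\<eta> > 0" "\<eta> \<le> 1"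
    using m \<kappa> c by (auto simp: N_def K_def \<eta>_def intro!: add_pos_pos add_pos_nonneg)
  then have M: "M > 0" "M \<ge> N" using m by (auto simp: M_def intro: add_pos_pos)
  show thesis
  proof
    \<comment> \<open>The constant comes from \<open>\<eta> * t * (m / 2) * Q t \<le> G t \<le> G 0
      \<le> (M + K) * s\<close>.\<close>
    show "2 * (M + K) / (\<eta> * m) > 0" using pos' M m by simp
    fix x y z w and t :: real
    assume sol: "strong_solution c x y z w" and t: "t > 0"
    define s where "s = (norm (x 0))\<^sup>2 + (norm (y 0))\<^sup>2 + (norm (z 0))\<^sup>2 + (norm (w 0))\<^sup>2"
    define Q where "Q t = (norm (T (x t)))\<^sup>2 + (norm (T (y t)))\<^sup>2 + (norm (T (z t)))\<^sup>2 + (norm (T (w t)))\<^sup>2" for t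
    define F where "F t = energy c (T (x t)) (T (y t)) (T (z t)) (T (w t))" for t
    define L where "L t = M * energy c (x t) (y t) (z t) (w t) + correction c \<eta> (x t) (y t) (z t) (w t)" for t
    define G where "G t = L t + \<eta> * t * F t" for t
    have F: "m / 2 * Q t \<le> F t" "F t \<le> Q t" for t
      using energy_bounds[OF a, where x = "T (x t)" and y = "T (y t)" and z = "T (z t)" and w = "T (w t)"]
      by (auto simp: F_def Q_def m_def)
    have deriv: "\<exists>D. (G has_vector_derivative D) (at t within {0..}) \<and> D \<le> 0" if t: "t \<ge> 0" for t
    proof -
      obtain a' b d e where *:
        "x t = T a'" "y t = T b" "z t = T d" "w t = T e"
        "(x has_vector_derivative b) (at t within {0..})"
        "(y has_vector_derivative - y t - a' - c *\<^sub>R T (z t)) (at t within {0..})"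
        "(z has_vector_derivative e) (at t within {0..})"
        "(w has_vector_derivative - d - c *\<^sub>R T (x t)) (at t within {0..})"
        using sol t unfolding strong_solution_def by blast
      note ders = strong_derivatives[OF *(5,1,6,2,7,3,8,4)]
      \<comment> \<open>Applying \<open>T\<close> to all components preserves the equations, with
        preimages \<open>T a'\<close>, \<open>T b\<close>, \<open>T d\<close>, \<open>T e\<close>;
        so the energy law holds for \<open>F\<close> too.\<close>
      have dF: "(F has_vector_derivative - (T (y t) \<bullet> T (y t))) (at t within {0..})"
        unfolding F_def
        by (rule strong_derivatives(1)[where a = "T a'" and b = "T b" and d = "T d" and e = "T e"])
          (use *(1-4) has_vector_derivative[OF *(5)] has_vector_derivative[OF *(6)]
            has_vector_derivative[OF *(7)] has_vector_derivative[OF *(8)]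
           in \<open>simp_all add: diff neg scaleR\<close>)
      obtain l where l: "((\<lambda>s. correction c \<eta> (x s) (y s) (z s) (w s)) has_vector_derivative l) (at t within {0..})"
        "l \<le> N * (y t \<bullet> y t) - \<eta> * Q t"
        using ders(2)[OF c, of \<eta>] dissipation[OF a m_def \<eta>_def, of "x t" "z t" "y t" "w t", folded N_def]
        unfolding Q_def by blast
      have "(G has_vector_derivative (M * (- (y t \<bullet> y t)) + l
          + (\<eta> * t * (- (T (y t) \<bullet> T (y t))) + \<eta> * F t))) (at t within {0..})"
        unfolding G_def L_def
        by (rule derivative_eq_intros l(1) ders(1) dF refl)+ simp
      \<comment> \<open>Differentiating the factor \<open>t\<close> produces
        \<open>\<eta> * F t\<close>, which \<open>- \<eta> * Q t\<close> absorbs because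
        \<open>F \<le> Q\<close>.\<close>
      moreover have "M * (- (y t \<bullet> y t)) + l + (\<eta> * t * (- (T (y t) \<bullet> T (y t))) + \<eta> * F t) \<le> 0"
      proof -
        have "N * (y t \<bullet> y t) \<le> M * (y t \<bullet> y t)" using M by (intro mult_right_mono) auto
        moreover have "\<eta> * F t \<le> \<eta> * Q t" using F(2)[of t] pos' by simp
        moreover have "0 \<le> \<eta> * t * (T (y t) \<bullet> T (y t))" using pos' t by simp
        ultimately show ?thesis using l(2) by simp
      qed
      ultimately show ?thesis by blast
    qed
    have "G t \<le> G 0"
    proof (rule DERIV_nonpos_imp_decreasing_open[OF less_imp_le[OF t]])
      fix s assume "0 < s" "s < t"
      then obtain D where D: "(G has_vector_derivative D) (at s within {0..})" "D \<le> 0"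
        using deriv[of s] by auto
      have "at s within {0..} = at s"
        by (rule at_within_interior) (use \<open>0 < s\<close> in \<open>simp add: interior_real_atLeast\<close>)
      then show "\<exists>y. DERIV G s :> y \<and> y \<le> 0"
        using D by (auto simp: has_real_derivative_iff_has_vector_derivative)
    next
      have "continuous_on {0..} G"
        unfolding continuous_on_eq_continuous_within using deriv has_vector_derivative_continuous by fastforce
      then show "continuous_on {0..t} G" by (rule continuous_on_subset) auto
    qed
    also have "G 0 \<le> (M + K) * s"
    proof -
      have "energy c (x 0) (y 0) (z 0) (w 0) \<le> s" unfolding s_def by (rule energy_bounds(2)[OF a])
      then have "M * energy c (x 0) (y 0) (z 0) (w 0) \<le> M * s" using M by simp
      moreover have "correction c \<eta> (x 0) (y 0) (z 0) (w 0) \<le> K * s"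
        using correction_le[OF a less_imp_le[OF pos'(3)] pos'(4), of "x 0" "y 0" "z 0" "w 0"]
        unfolding s_def K_def by linarith
      ultimately show ?thesis by (simp add: G_def L_def distrib_right)
    qed
    finally have "G t \<le> (M + K) * s" .
    moreover have "L t \<ge> 0"
    proof -
      define S where "S = (norm (x t))\<^sup>2 + (norm (y t))\<^sup>2 + (norm (z t))\<^sup>2 + (norm (w t))\<^sup>2"
      have e: "m / 2 * S \<le> energy c (x t) (y t) (z t) (w t)"
        unfolding S_def m_def by (rule energy_bounds(1)[OF a])
      have "S \<ge> 0" by (simp add: S_def)
      then have "K * S \<le> M * (m / 2) * S"
        using m pos' by (intro mult_right_mono) (auto simp: M_def field_simps)
      also have "\<dots> \<le> M * energy c (x t) (y t) (z t) (w t)"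
        using mult_left_mono[OF e, of M] M by simp
      finally show ?thesis
        using correction_le[OF a less_imp_le[OF pos'(3)] pos'(4), of "x t" "y t" "z t" "w t"]
        unfolding L_def S_def K_def by linarith
    qed
    moreover have "\<eta> * t * (m / 2 * Q t) \<le> \<eta> * t * F t"
      using F(1) pos' t by (intro mult_left_mono) auto
    ultimately have "\<eta> * t * (m / 2 * Q t) \<le> (M + K) * s" by (simp add: G_def)
    then have "Q t \<le> 2 * (M + K) / (\<eta> * m) * (s / t)"
      using m pos' t by (simp add: field_simps)
    then show "(norm (T (x t)))\<^sup>2 + (norm (T (y t)))\<^sup>2 + (norm (T (z t)))\<^sup>2 + (norm (T (w t)))\<^sup>2
      \<le> 2 * (M + K) / (\<eta> * m) * (((norm (x 0))\<^sup>2 + (norm (y 0))\<^sup>2 + (norm (z 0))\<^sup>2 + (norm (w 0))\<^sup>2) / t)"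
      unfolding Q_def s_def .
  qed
qed

end

subsection \<open>Regularization of weak solutions\<close>

text \<open>\<open>T + \<epsilon>\<close> is self-adjoint and bounded below by \<epsilon>, and
  \<open>R\<close> is its inverse. Expanding the squared norm of
  \<open>z = T (R z) + \<epsilon> *\<^sub>R R z\<close> gives a nonnegative cross term, so each
  summand has norm at most \<open>norm z\<close>.\<close>

lemma positive_operator_resolvent:
  fixes T :: "'h::{real_inner, complete_space} \<Rightarrow> 'h"
  assumes "positive_operator T" and \<epsilon>: "\<epsilon> > 0"
  obtains R where "bounded_linear R" "\<And>z. T (R z) + \<epsilon> *\<^sub>R R z = z" "\<And>z. R (T z) = T (R z)"
    "\<And>z. norm (T (R z)) \<le> norm z" "\<And>z. norm (\<epsilon> *\<^sub>R R z) \<le> norm z"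
proof -
  interpret T: positive_operator T by fact
  let ?G = "{(x, T x) | x. True}"
  have "self_adjoint ?G"
  proof -
    have "subspace ?G"
      unfolding subspace_def
      by (auto simp: zero_prod_def T.zero T.add T.scaleR intro: exI[of _ 0])
    moreover have "(\<forall>(x, w)\<in>?G. w \<bullet> y = x \<bullet> z) \<longleftrightarrow> z = T y" for y z
    proof -
      have "(\<forall>(x, w)\<in>?G. w \<bullet> y = x \<bullet> z) \<longleftrightarrow> (\<forall>x. x \<bullet> T y = x \<bullet> z)" by (auto simp: T.sym)
      also have "\<dots> \<longleftrightarrow> z = T y" using vector_eq_ldot[of "T y" z] by auto
      finally show ?thesis .
    qed
    then have "op_adjoint ?G = ?G" unfolding op_adjoint_def by auto
    moreover have "single_valued ?G" "Domain ?G = UNIV" by (auto simp: single_valued_def)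
    ultimately show ?thesis unfolding self_adjoint_def linear_operator_def by simp
  qed
  note S = self_adjoint_shift[OF this, of "- \<epsilon>"]
  have "\<epsilon> * (norm x)\<^sup>2 \<le> y \<bullet> x" if "(x, y) \<in> {(x, y - (- \<epsilon>) *\<^sub>R x) | x y. (x, y) \<in> ?G}" for x y
    using that T.pos[of x] by (auto simp: inner_add_left dot_square_norm)
  from self_adjoint_bounded_below_inverse[OF S \<epsilon> this]
  obtain R where R: "bounded_linear R"
    "{(x, y - (- \<epsilon>) *\<^sub>R x) | x y. (x, y) \<in> ?G} = {(R z, z) | z. True}" by blast
  interpret R: bounded_linear R by (rule R)
  have TR: "T (R z) + \<epsilon> *\<^sub>R R z = z" for z
  proof -
    have "(R z, z) \<in> {(x, y - (- \<epsilon>) *\<^sub>R x) | x y. (x, y) \<in> ?G}" unfolding R(2) by blast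
    then show ?thesis by auto
  qed
  have RT: "R (T x + \<epsilon> *\<^sub>R x) = x" for x
  proof -
    have "(x, T x - (- \<epsilon>) *\<^sub>R x) \<in> {(R z, z) | z. True}" unfolding R(2)[symmetric] by blast
    then show ?thesis by auto
  qed
  have sq: "(norm z)\<^sup>2 = (norm (T (R z)))\<^sup>2 + 2 * \<epsilon> * (T (R z) \<bullet> R z) + (norm (\<epsilon> *\<^sub>R R z))\<^sup>2" for z
    unfolding power2_norm_eq_inner
    by (subst (1 2) TR[of z, symmetric]) (simp add: inner_add_left inner_add_right inner_commute)
  have ge: "0 \<le> 2 * \<epsilon> * (T (R z) \<bullet> R z)" for z using T.pos \<epsilon> by simp
  show thesis
  proof (rule that[OF R(1) TR])
    show "R (T z) = T (R z)" for z
      using RT[of "T (R z)"] TR[of z] by (metis T.add T.scaleR)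
    show "norm (T (R z)) \<le> norm z" for z
      by (rule power2_le_imp_le) (use sq[of z] ge[of z] in auto)
    show "norm (\<epsilon> *\<^sub>R R z) \<le> norm z" for z
      by (rule power2_le_imp_le) (use sq[of z] ge[of z] in auto)
  qed
qed

text \<open>With \<open>\<epsilon> = 1 / Suc n\<close>, the error \<open>z - T (R n z)\<close> is
  \<open>\<epsilon> *\<^sub>R R n z\<close>. For \<open>z = T y\<close> it is at most \<epsilon>
  times \<open>norm y\<close>; the uniform bounds extend convergence from the dense range of
  \<open>T\<close> to all \<open>z\<close>.\<close>

lemma positive_operator_approximate_identity:
  fixes T :: "'h::{real_inner, complete_space} \<Rightarrow> 'h"
  assumes T: "positive_operator T" and dense: "closure (range T) = UNIV"
  obtains R where "\<And>n. bounded_linear (R n)" "\<And>n z. R n (T z) = T (R n z)"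
    "\<And>n z. norm (T (R n z)) \<le> norm z" "\<And>z. (\<lambda>n. T (R n z)) \<longlonglongrightarrow> z"
proof -
  have "\<forall>n. \<exists>R. bounded_linear R \<and> (\<forall>z. T (R z) + (1 / Suc n) *\<^sub>R R z = z) \<and> (\<forall>z. R (T z) = T (R z))
      \<and> (\<forall>z. norm (T (R z)) \<le> norm z) \<and> (\<forall>z. norm ((1 / Suc n) *\<^sub>R R z) \<le> norm z)"
  proof
    fix n
    have "1 / real (Suc n) > 0" by simp
    from positive_operator_resolvent[OF T this]
    show "\<exists>R. bounded_linear R \<and> (\<forall>z. T (R z) + (1 / Suc n) *\<^sub>R R z = z) \<and> (\<forall>z. R (T z) = T (R z))
      \<and> (\<forall>z. norm (T (R z)) \<le> norm z) \<and> (\<forall>z. norm ((1 / Suc n) *\<^sub>R R z) \<le> norm z)" by metis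
  qed
  then obtain R where R: "\<And>n. bounded_linear (R n)" "\<And>n z. T (R n z) + (1 / Suc n) *\<^sub>R R n z = z"
    "\<And>n z. R n (T z) = T (R n z)" "\<And>n z. norm (T (R n z)) \<le> norm z"
    "\<And>n z. norm ((1 / Suc n) *\<^sub>R R n z) \<le> norm z" by metis
  have "(\<lambda>n. T (R n z)) \<longlonglongrightarrow> z" for z
  proof (rule LIMSEQ_I)
    fix e :: real assume e: "e > 0"
    have "z \<in> closure (range T)" using dense by simp
    then obtain y where y: "norm (z - T y) < e / 2"
      using e closure_approachable[of z "range T"]
      by (metis dist_norm half_gt_zero norm_minus_commute rangeE)
    have "(\<lambda>n. (1 / Suc n) * norm y) \<longlonglongrightarrow> 0 * norm y"
      by (intro tendsto_intros LIMSEQ_Suc[OF lim_1_over_n])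
    then have "\<forall>\<^sub>F n in sequentially. (1 / Suc n) * norm y < e / 2"
      using e by (intro order_tendstoD) auto
    then obtain N where N: "\<And>n. n \<ge> N \<Longrightarrow> (1 / Suc n) * norm y < e / 2"
      by (auto simp: eventually_sequentially)
    have "norm (T (R n z) - z) < e" if "n \<ge> N" for n
    proof -
      interpret Rn: bounded_linear "R n" by (rule R)
      let ?\<epsilon> = "1 / real (Suc n)"
      have "z - T (R n z) = ?\<epsilon> *\<^sub>R R n z" using R(2)[of n z] by (metis add_diff_cancel_left')
      also have "\<dots> = ?\<epsilon> *\<^sub>R R n (z - T y) + ?\<epsilon> *\<^sub>R T (R n y)"
        by (simp only: Rn.diff R(3) scaleR_diff_right) simp
      finally have "norm (T (R n z) - z) \<le> norm (?\<epsilon> *\<^sub>R R n (z - T y)) + norm (?\<epsilon> *\<^sub>R T (R n y))"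
        by (metis norm_minus_commute norm_triangle_ineq)
      also have "norm (?\<epsilon> *\<^sub>R T (R n y)) \<le> ?\<epsilon> * norm y"
        using mult_left_mono[OF R(4), of ?\<epsilon> n y] by simp
      finally show ?thesis using R(5)[of n "z - T y"] y N[OF that] by linarith
    qed
    then show "\<exists>no. \<forall>n\<ge>no. norm (T (R n z) - z) < e" by blast
  qed
  with that[of R] R show thesis by blast
qed

text \<open>Every element of V is some \<open>T z\<close>, so testing with it turns the equations in
  V' into derivatives in H of \<open>T (u1 s)\<close> and \<open>T (v1 s)\<close>. Commuting
  \<open>R\<close> past \<open>T\<close> then shows that all four components lie in the range of
  \<open>T\<close>, with preimages \<open>R p\<close>, \<open>R (u1 t)\<close>, \<open>R r\<close>,
  \<open>R (v1 t)\<close>.\<close>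

lemma (in inverse_sqrt) weak_solution_regularized:
  assumes sol: "weak_solution A c u v u1 v1" and R: "bounded_linear R" "\<And>z. R (T z) = T (R z)"
  shows "strong_solution c (\<lambda>t. R (u t)) (\<lambda>t. R (T (u1 t))) (\<lambda>t. R (v t)) (\<lambda>t. R (T (v1 t)))"
  unfolding strong_solution_def
proof (intro allI impI)
  fix t :: real assume t: "t \<ge> 0"
  interpret R: bounded_linear R by (rule R)
  define p where "p = op_app (sqrt_op A) (u t)"
  define r where "r = op_app (sqrt_op A) (v t)"
  obtain u2 v2 where reg: "weak_regularity A u u1 u2" "weak_regularity A v v1 v2"
    and "(\<lambda>w. u2 t w + H_to_dual A (u1 t) w + A_ext A (u t) w + c * H_to_dual A (v t) w) = (\<lambda>w. 0)"
      "(\<lambda>w. v2 t w + A_ext A (v t) w + c * H_to_dual A (u t) w) = (\<lambda>w. 0)"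
    using sol t unfolding weak_solution_def by blast
  then have eq: "u2 t w + H_to_dual A (u1 t) w + A_ext A (u t) w + c * H_to_dual A (v t) w = 0"
      "v2 t w + A_ext A (v t) w + c * H_to_dual A (u t) w = 0" for w
    by (simp_all add: fun_eq_iff)
  have up: "u t = T p" and vr: "v t = T r"
    using weak_regularity_V[OF reg(1) t] weak_regularity_V[OF reg(2) t] by (auto simp: p_def r_def)
  have dual: "H_to_dual A h (T z) = T h \<bullet> z" for h z by (simp add: H_to_dual_def V_space sym)
  have ext: "A_ext A (u t) (T z) = p \<bullet> z" "A_ext A (v t) (T z) = r \<bullet> z" for z
    by (simp_all add: A_ext_def V_space op_app_sqrt_op p_def r_def)
  have "u2 t (T z) = (- T (u1 t) - p - c *\<^sub>R T (v t)) \<bullet> z" for z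
    using eq(1)[of "T z"] by (simp add: dual ext inner_diff_left)
  from weak_regularity_derivative[OF reg(1) t this]
  have "((\<lambda>s. T (u1 s)) has_vector_derivative - T (u1 t) - p - c *\<^sub>R T (v t)) (at t within {0..})" .
  from R.has_vector_derivative[OF this]
  have 1: "((\<lambda>s. R (T (u1 s))) has_vector_derivative - R (T (u1 t)) - R p - c *\<^sub>R T (R (v t))) (at t within {0..})"
    by (simp add: R.diff R.neg R.scaleR R(2))
  have "v2 t (T z) = (- r - c *\<^sub>R T (u t)) \<bullet> z" for z
    using eq(2)[of "T z"] by (simp add: dual ext inner_diff_left)
  from weak_regularity_derivative[OF reg(2) t this]
  have "((\<lambda>s. T (v1 s)) has_vector_derivative - r - c *\<^sub>R T (u t)) (at t within {0..})" .
  from R.has_vector_derivative[OF this]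
  have 2: "((\<lambda>s. R (T (v1 s))) has_vector_derivative - R r - c *\<^sub>R T (R (u t))) (at t within {0..})"
    by (simp add: R.diff R.neg R.scaleR R(2))
  have 3: "((\<lambda>s. R (u s)) has_vector_derivative R (u1 t)) (at t within {0..})"
    "((\<lambda>s. R (v s)) has_vector_derivative R (v1 t)) (at t within {0..})"
    using reg t unfolding weak_regularity_def by (auto intro: R.has_vector_derivative)
  show "\<exists>a b d e. R (u t) = T a \<and> R (T (u1 t)) = T b \<and> R (v t) = T d \<and> R (T (v1 t)) = T e \<and>
    ((\<lambda>t. R (u t)) has_vector_derivative b) (at t within {0..}) \<and>
    ((\<lambda>t. R (T (u1 t))) has_vector_derivative - R (T (u1 t)) - a - c *\<^sub>R T (R (v t))) (at t within {0..}) \<and>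
    ((\<lambda>t. R (v t)) has_vector_derivative e) (at t within {0..}) \<and>
    ((\<lambda>t. R (T (v1 t))) has_vector_derivative - d - c *\<^sub>R T (R (u t))) (at t within {0..})"
    by (rule exI[of _ "R p"], rule exI[of _ "R (u1 t)"], rule exI[of _ "R r"], rule exI[of _ "R (v1 t)"])
      (use 1 2 3 in \<open>simp add: up vr R(2)\<close>)
qed

section \<open>Passage to the limit in the regularization\<close>

theorem corollary7p2:
  fixes A :: "'h::{real_inner, complete_space} operator" and c :: real
  assumes "separable_space (euclidean :: 'h topology)"
    and "self_adjoint A" and "nonneg_operator A" and "coercive A"
    and "c \<noteq> 0" and "\<bar>c\<bar> < lambda1 A"
  shows "\<exists>C>0. \<forall>u v u1 v1. weak_solution A c u v u1 v1 \<longrightarrow>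
    (\<forall>t>0. (norm (u t))\<^sup>2 + (norm (v t))\<^sup>2
            + (dual_norm A (H_to_dual A (u1 t)))\<^sup>2 + (dual_norm A (H_to_dual A (v1 t)))\<^sup>2
          \<le> C * (((V_norm A (u 0))\<^sup>2 + (V_norm A (v 0))\<^sup>2
                  + (norm (u1 0))\<^sup>2 + (norm (v1 0))\<^sup>2) / t))"
proof -
  define l where "l = lambda1 A"
  have l: "l > 0" using assms(6) by (simp add: l_def)
  have lower: "l * (norm x)\<^sup>2 \<le> y \<bullet> x" if "(x, y) \<in> A" for x y
    unfolding l_def by (rule lambda1_lower_bound[OF assms(2,3) that])
  obtain T where T: "positive_operator T" "\<And>x. T x = 0 \<Longrightarrow> x = 0" "closure (range T) = UNIV"
    "\<And>x. (norm (T x))\<^sup>2 \<le> (1 / l) * (norm x)\<^sup>2" "sqrt_op A = {(T z, z) | z. True}"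
    using sqrt_op_inverse[OF assms(2) l lower] by blast
  interpret inverse_sqrt T A
    by (rule inverse_sqrt.intro[OF T(1)], rule inverse_sqrt_axioms.intro) (fact T)+
  have "1 / l > 0" "\<bar>c\<bar> * (1 / l) < 1" using assms(6) l by (simp_all add: l_def)
  \<comment> \<open>Here \<kappa> is the inverse of the least spectral value, so the smallness
    condition is exactly the hypothesis on \<open>c\<close>.\<close>
  note decay = strong_solution_decay[OF this(1) T(4) assms(5) this(2)]
  obtain C where C: "C > 0" "\<And>x y z w t. strong_solution c x y z w \<Longrightarrow> t > 0 \<Longrightarrow>
      (norm (T (x t)))\<^sup>2 + (norm (T (y t)))\<^sup>2 + (norm (T (z t)))\<^sup>2 + (norm (T (w t)))\<^sup>2
      \<le> C * (((norm (x 0))\<^sup>2 + (norm (y 0))\<^sup>2 + (norm (z 0))\<^sup>2 + (norm (w 0))\<^sup>2) / t)"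
    by (rule decay) (rule that)
  obtain R where R: "\<And>n. bounded_linear (R n)" "\<And>n z. R n (T z) = T (R n z)"
    "\<And>n z. norm (T (R n z)) \<le> norm z" "\<And>z. (\<lambda>n. T (R n z)) \<longlonglongrightarrow> z"
    using positive_operator_approximate_identity[OF T(1,3)] by blast
  show ?thesis
  proof (intro exI[of _ C] conjI allI impI C(1))
    fix u v u1 v1 and t :: real
    assume sol: "weak_solution A c u v u1 v1" and t: "t > 0"
    define s where "s = (V_norm A (u 0))\<^sup>2 + (V_norm A (v 0))\<^sup>2 + (norm (u1 0))\<^sup>2 + (norm (v1 0))\<^sup>2"
    \<comment> \<open>The uniform bound concerns \<open>T (R n z)\<close>. Writing
      \<open>u 0 = T p\<close> turns \<open>R n (u 0)\<close> into \<open>T (R n p)\<close>, of norm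
      at most \<open>norm p\<close>, the V norm of \<open>u 0\<close>.\<close>
    have initial: "norm (R n (u 0)) \<le> V_norm A (u 0)" "norm (R n (v 0)) \<le> V_norm A (v 0)" for n
    proof -
      obtain u2 v2 where reg: "weak_regularity A u u1 u2" "weak_regularity A v v1 v2"
        using sol unfolding weak_solution_def by blast
      have "norm (R n (T (op_app (sqrt_op A) (u 0)))) \<le> V_norm A (u 0)"
        "norm (R n (T (op_app (sqrt_op A) (v 0)))) \<le> V_norm A (v 0)"
        by (simp_all add: R(2) R(3) V_norm_def)
      then show "norm (R n (u 0)) \<le> V_norm A (u 0)" "norm (R n (v 0)) \<le> V_norm A (v 0)"
        by (simp_all add: weak_regularity_V[OF reg(1)] weak_regularity_V[OF reg(2)])
    qed
    have "(norm (T (R n (u t))))\<^sup>2 + (norm (T (R n (v t))))\<^sup>2 + (norm (T (R n (T (u1 t)))))\<^sup>2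
      + (norm (T (R n (T (v1 t)))))\<^sup>2 \<le> C * (s / t)" for n
    proof -
      have "(norm (T (R n (u t))))\<^sup>2 + (norm (T (R n (T (u1 t)))))\<^sup>2 + (norm (T (R n (v t))))\<^sup>2
        + (norm (T (R n (T (v1 t)))))\<^sup>2
        \<le> C * (((norm (R n (u 0)))\<^sup>2 + (norm (R n (T (u1 0))))\<^sup>2 + (norm (R n (v 0)))\<^sup>2
          + (norm (R n (T (v1 0))))\<^sup>2) / t)"
        using C(2)[OF weak_solution_regularized[OF sol R(1) R(2)] t] .
      also have "\<dots> \<le> C * (((V_norm A (u 0))\<^sup>2 + (norm (u1 0))\<^sup>2 + (V_norm A (v 0))\<^sup>2
          + (norm (v1 0))\<^sup>2) / t)"
        by (intro mult_left_mono divide_right_mono add_mono power_mono initial)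
          (use C(1) t R(3) in \<open>auto simp: R(2)\<close>)
      finally show ?thesis by (simp add: s_def add_ac)
    qed
    \<comment> \<open>The bound \<open>C * (s / t)\<close> is independent of \<open>n\<close>, so it
      passes to the strong limit at fixed \<open>t\<close>; the limits of the velocity terms are
      dual norms by \<open>dual_norm_H\<close>.\<close>
    moreover have "(\<lambda>n. (norm (T (R n (u t))))\<^sup>2 + (norm (T (R n (v t))))\<^sup>2
        + (norm (T (R n (T (u1 t)))))\<^sup>2 + (norm (T (R n (T (v1 t)))))\<^sup>2)
      \<longlonglongrightarrow> (norm (u t))\<^sup>2 + (norm (v t))\<^sup>2 + (norm (T (u1 t)))\<^sup>2 + (norm (T (v1 t)))\<^sup>2"
      by (intro tendsto_intros R(4))
    ultimately show "(norm (u t))\<^sup>2 + (norm (v t))\<^sup>2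
            + (dual_norm A (H_to_dual A (u1 t)))\<^sup>2 + (dual_norm A (H_to_dual A (v1 t)))\<^sup>2
          \<le> C * (((V_norm A (u 0))\<^sup>2 + (V_norm A (v 0))\<^sup>2
                  + (norm (u1 0))\<^sup>2 + (norm (v1 0))\<^sup>2) / t)"
      unfolding dual_norm_H s_def[symmetric] by (intro LIMSEQ_le_const2) blast+
  qed
qed

end
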